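(* Let $K\subset\mathbb{R}^4$ be an origin-symmetric convex body of revolution (around the $x_4$ axis) whose radial function $\rho_K(t)$, written as a function of $t\in[0,1]$, the cosine of the angle with the axis of revolution, is of class $C^2$ in a neighborhood of $t=1$. If $$2\rho_K^4(1) > 3\left(\int_0^1 \rho_K^3(t)\,dt\right)\left(\rho_K(1)+\rho_K'(1)\right),$$ then the intersection body $IK$ of $K$ is not a polar zonoid.
   Context: Let $n=4$. A convex body in $\mathbb{R}^n$ is a compact convex set with nonempty interior. The radial function of an origin-symmetric convex body $K$ is $\rho_K(\xi)=\max\{\lambda\ge 0:\lambda\xi\in K\}$, $\xi\in S^{n-1}$. If $K$ is an origin-symmetric convex body of revolution around the $x_n$ axis (i.e. invariant under all rotations fixing that axis), then $\rho_K(\sqrt{1-t^2}\,\xi,t)$ is independent of $\xi\in S^{n-2}$, and one writes $\rho_K(t)=\rho_K(\sqrt{1-t^2}\,\xi,t)$ for $0\le t\le 1$; thus $t$ is the cosine of the angle with the axis of revolution, $t=1$ corresponds to the axis of revolution and $t=0$ to the equator. Primes denote derivatives with respect to $t$; since $t$ ranges over $[0,1]$, neighborhoods of $t=1$ are taken in $[0,1]$ and derivatives at $t=1$ are one-sided. The intersection body $IK$ of $K$ is the origin-symmetric star body with radial function $\rho_{IK}(\xi)=\mathrm{Vol}_{n-1}(K\cap\xi^\perp)$, $\xi\in S^{n-1}$ (it is convex, by Busemann's theorem). The support function of a compact convex set $Z$ is $h_Z(x)=\sup\{\langle x,u\rangle:u\in Z\}$. A compact convex set $Z\subset\mathbb{R}^n$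 is a zonoid (centered at the origin) if there is a finite non-negative even Borel measure $\mu$ on $S^{n-1}$ with $h_Z(u)=\int_{S^{n-1}}|\langle u,v\rangle|\,d\mu(v)$ for all $u\in S^{n-1}$. A convex body is a polar zonoid if it is the polar body of such a zonoid; equivalently (since $h_{L^*}=1/\rho_L$), an origin-symmetric convex body $L$ is a polar zonoid if its polar body $L^*=\{x:\langle x,y\rangle\le 1\ \forall y\in L\}$ is a zonoid. *)

theory Defs
  imports "HOL-Analysis.Analysis"
begin

definition convex_body :: "'a::euclidean_space set \<Rightarrow> bool" where
  "convex_body K \<longleftrightarrow> compact K \<and> convex K \<and> interior K \<noteq> {}"

definition origin_symmetric :: "'a::real_vector set \<Rightarrow> bool" where
  "origin_symmetric K \<longleftrightarrow> (\<forall>x\<in>K. - x \<in> K)"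

text \<open>The supremum is attained, i.e. it is a maximum, when \<open>K\<close> is a compact set containing the
  origin and \<open>x \<noteq> 0\<close>.\<close>

definition radial :: "'a::real_vector set \<Rightarrow> 'a \<Rightarrow> real" where
  "radial K x = Sup {c. 0 \<le> c \<and> c *\<^sub>R x \<in> K}"

definition support :: "'a::real_inner set \<Rightarrow> 'a \<Rightarrow> real" where
  "support Z x = Sup {x \<bullet> u | u. u \<in> Z}"

definition polar :: "'a::real_inner set \<Rightarrow> 'a set" where
  "polar L = {x. \<forall>y\<in>L. x \<bullet> y \<le> 1}"


text \<open>\<open>Z \<noteq> {}\<close> is spelled out because \<open>support {}\<close> would be an arbitrary constant.\<close>

definition zonoid :: "'a::euclidean_space set \<Rightarrow> bool" where
  "zonoid Z \<longleftrightarrow> compact Z \<and> convex Z \<and> Z \<noteq> {} \<and>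
     (\<exists>\<mu>. sets \<mu> = sets (restrict_space borel (sphere (0::'a) 1)) \<and> finite_measure \<mu> \<and>
          (\<forall>A\<in>sets \<mu>. emeasure \<mu> (uminus ` A) = emeasure \<mu> A) \<and>
          (\<forall>u\<in>sphere 0 1. support Z u = (\<integral>v. \<bar>u \<bullet> v\<bar> \<partial>\<mu>)))"

definition polar_zonoid :: "'a::euclidean_space set \<Rightarrow> bool" where
  "polar_zonoid L \<longleftrightarrow> convex_body L \<and> (\<exists>Z. zonoid Z \<and> L = polar Z)"


text \<open>Three-dimensional volume inside the hyperplane orthogonal to \<open>\<xi>\<close>: Lebesgue measure on
  \<open>\<real>\<^sup>3\<close> transported by a linear isometry of \<open>\<real>\<^sup>3\<close> onto that hyperplane.  Such an isometry exists,
  and the value does not depend on which one is chosen (see \<open>section_volume_eq\<close> below).\<close>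

definition hyperplane_isometry :: "real^4 \<Rightarrow> (real^3 \<Rightarrow> real^4) \<Rightarrow> bool" where
  "hyperplane_isometry \<xi> f \<longleftrightarrow>
     linear f \<and> (\<forall>y. norm (f y) = norm y) \<and> range f = {x. \<xi> \<bullet> x = 0}"

definition section_volume :: "(real^4) set \<Rightarrow> real^4 \<Rightarrow> real" where
  "section_volume K \<xi> =
     measure lebesgue ((SOME f. hyperplane_isometry \<xi> f) -` (K \<inter> {x. \<xi> \<bullet> x = 0}))"

definition intersection_body :: "(real^4) set \<Rightarrow> (real^4) set" where
  "intersection_body K = {c *\<^sub>R \<xi> | c \<xi>. norm \<xi> = 1 \<and> 0 \<le> c \<and> c \<le> section_volume K \<xi>}"


text \<open>Invariance under all rotations that fix the \<open>x\<^sub>4\<close> axis pointwise.\<close>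

definition body_of_revolution :: "(real^4) set \<Rightarrow> bool" where
  "body_of_revolution K \<longleftrightarrow>
     (\<forall>Q. rotation_matrix Q \<and> Q *v axis 4 1 = axis 4 1 \<longrightarrow> (\<lambda>x. Q *v x) ` K = K)"

text \<open>The radial function in terms of the cosine \<open>t\<close> of the angle with the \<open>x\<^sub>4\<close> axis.  For bodies
  of revolution the meridian direction, here \<open>axis 1 1\<close>, is immaterial (see \<open>radial_profile_eq\<close>
  below).\<close>

definition radial_profile :: "(real^4) set \<Rightarrow> real \<Rightarrow> real" where
  "radial_profile K t = radial K (sqrt (1 - t\<^sup>2) *\<^sub>R axis 1 1 + t *\<^sub>R axis 4 1)"

text \<open>Derivatives are taken within \<open>S\<close>, hence one-sided at end points of intervals.\<close>

definition C2_on :: "real set \<Rightarrow> (real \<Rightarrow> real) \<Rightarrow> bool" where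
  "C2_on S f \<longleftrightarrow>
     (\<exists>f' f''. (\<forall>t\<in>S. (f has_real_derivative f' t) (at t within S)) \<and>
               (\<forall>t\<in>S. (f' has_real_derivative f'' t) (at t within S)) \<and>
               continuous_on S f'')"


lemma hyperplane_isometry_exists:
  assumes "\<xi> \<noteq> 0"
  shows "\<exists>f. hyperplane_isometry \<xi> f"
proof -
  have d: "dim (UNIV :: (real^3) set) = dim {x. \<xi> \<bullet> x = 0}"
    using dim_hyperplane[OF assms] by simp
  obtain f g where "linear f" "f ` UNIV = {x. \<xi> \<bullet> x = 0}" "\<And>x::real^3. norm (f x) = norm x"
    using isometries_subspaces[OF subspace_UNIV subspace_hyperplane d] by (metis UNIV_I)
  then show ?thesis
    unfolding hyperplane_isometry_def by blast
qed

lemma section_volume_eq: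
  assumes f: "hyperplane_isometry \<xi> f" and "\<xi> \<noteq> 0" and K: "compact K"
  shows "section_volume K \<xi> = measure lebesgue (f -` (K \<inter> {x. \<xi> \<bullet> x = 0}))"
proof -
  define g where "g = (SOME f. hyperplane_isometry \<xi> f)"
  have g: "hyperplane_isometry \<xi> g"
    unfolding g_def using hyperplane_isometry_exists[OF \<open>\<xi> \<noteq> 0\<close>] by (rule someI_ex)
  let ?H = "{x. \<xi> \<bullet> x = 0}"
  have inj: "inj h" if "hyperplane_isometry \<xi> h" for h
  proof (rule injI)
    fix x y assume "h x = h y"
    have h: "linear h" "norm (h (x - y)) = norm (x - y)"
      using that by (auto simp: hyperplane_isometry_def)
    have "norm (x - y) = 0"
      unfolding h(2)[symmetric] linear_diff[OF h(1)] \<open>h x = h y\<close> by simp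
    then show "x = y" by simp
  qed
  define h where "h = inv f \<circ> g"
  have fh: "f (h x) = g x" for x
  proof -
    have "g x \<in> range f"
      using f g by (auto simp: hyperplane_isometry_def)
    then show ?thesis
      by (simp add: h_def f_inv_into_f)
  qed
  have lf: "linear f" and lg: "linear g"
    using f g by (auto simp: hyperplane_isometry_def)
  have "linear h"
  proof (rule linearI)
    fix x y show "h (x + y) = h x + h y"
      by (rule injD[OF inj[OF f]]) (simp add: fh linear_add[OF lf] linear_add[OF lg])
  next
    fix c x show "h (c *\<^sub>R x) = c *\<^sub>R h x"
      by (rule injD[OF inj[OF f]]) (simp add: fh linear_scale[OF lf] linear_scale[OF lg])
  qed
  moreover have "norm (h x) = norm x" for x
    using f g fh[of x] by (metis hyperplane_isometry_def)
  ultimately have h: "orthogonal_transformation h"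
    by (simp add: orthogonal_transformation)
  have img: "f -` (K \<inter> ?H) = h ` (g -` (K \<inter> ?H))"
  proof (rule set_eqI)
    fix y
    obtain x where "y = h x"
      using orthogonal_transformation_surj[OF h] by (metis surjD)
    moreover have "inj h"
      using h by (rule orthogonal_transformation_inj)
    ultimately show "y \<in> f -` (K \<inter> ?H) \<longleftrightarrow> y \<in> h ` (g -` (K \<inter> ?H))"
      by (simp add: fh inj_image_mem_iff)
  qed
  have "closed (g -` (K \<inter> ?H))"
    using lg K by (intro closed_vimage closed_Int compact_imp_closed closed_hyperplane
      linear_continuous_on linear_conv_bounded_linear[THEN iffD1])
  moreover have "bounded (g -` (K \<inter> ?H))"
  proof -
    obtain B where "\<And>x. x \<in> K \<Longrightarrow> norm x \<le> B"
      using compact_imp_bounded[OF K] by (auto simp: bounded_iff)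
    then show ?thesis
      using g unfolding bounded_iff hyperplane_isometry_def by (metis IntD1 vimageD)
  qed
  ultimately have "g -` (K \<inter> ?H) \<in> lmeasurable"
    by (simp add: lmeasurable_compact compact_eq_bounded_closed)
  from measure_orthogonal_image[OF h this] show ?thesis
    unfolding img section_volume_def g_def by simp
qed

lemma radial_intersection_body:
  assumes "norm \<xi> = 1"
  shows "radial (intersection_body K) \<xi> = section_volume K \<xi>"
proof -
  have "{c. 0 \<le> c \<and> c *\<^sub>R \<xi> \<in> intersection_body K} = {0..section_volume K \<xi>}"
  proof (intro set_eqI iffI)
    fix c assume "c \<in> {c. 0 \<le> c \<and> c *\<^sub>R \<xi> \<in> intersection_body K}"
    then obtain d \<eta> where d: "0 \<le> c" "c *\<^sub>R \<xi> = d *\<^sub>R \<eta>" "norm \<eta> = 1" "0 \<le> d" "d \<le> section_volume K \<eta>"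
      by (auto simp: intersection_body_def)
    have "norm (c *\<^sub>R \<xi>) = norm (d *\<^sub>R \<eta>)"
      using d(2) by (rule arg_cong)
    then have "c = d"
      using d(1,3,4) assms by simp
    moreover have "0 \<le> section_volume K \<xi>"
      by (simp add: section_volume_def)
    ultimately show "c \<in> {0..section_volume K \<xi>}"
      using d by (cases "c = 0") auto
  next
    fix c assume "c \<in> {0..section_volume K \<xi>}"
    then show "c \<in> {c. 0 \<le> c \<and> c *\<^sub>R \<xi> \<in> intersection_body K}"
      using assms by (auto simp: intersection_body_def)
  qed
  moreover have "0 \<le> section_volume K \<xi>"
    by (simp add: section_volume_def)
  ultimately show ?thesis
    by (simp add: radial_def)
qed

lemma rotation_to_meridian:
  fixes \<xi> :: "real^4"
  assumes "norm \<xi> = 1" "\<xi> $ 4 = 0"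
  shows "\<exists>Q. rotation_matrix Q \<and> Q *v axis 4 1 = axis 4 1 \<and> Q *v \<xi> = axis 1 1"
proof -
  define d where "d = \<xi> - axis 1 1"
  define s where "s x = x - (2 * (x \<bullet> d) / (d \<bullet> d)) *\<^sub>R d" for x
  have ls: "linear s"
    by (rule linearI)
      (simp_all add: s_def inner_add_left add_divide_distrib scaleR_left_distrib
        scaleR_right_diff_distrib distrib_left mult.left_commute)
  have "s x \<bullet> s x = x \<bullet> x" for x
    by (cases "d = 0") (simp_all add: s_def inner_diff_left inner_diff_right inner_commute)
  then have os: "orthogonal_transformation s"
    using ls by (simp add: orthogonal_transformation norm_eq_sqrt_inner)
  have e4: "s (axis 4 1) = axis 4 1"
  proof -
    have "axis 4 1 \<bullet> d = 0"
      unfolding d_def inner_axis' using assms by (simp add: axis_def)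
    then show ?thesis by (simp add: s_def)
  qed
  have dd: "d \<bullet> d = 2 * (\<xi> \<bullet> d)"
    using assms by (simp add: d_def inner_diff_left inner_diff_right inner_commute inner_axis_axis
      norm_eq_1[symmetric])
  have e1: "s \<xi> = axis 1 1"
  proof (cases "d = 0")
    case True then show ?thesis by (simp add: s_def d_def)
  next
    case False
    then have "s \<xi> = \<xi> - d" by (simp add: s_def dd[symmetric])
    then show ?thesis by (simp add: d_def)
  qed
  define A where "A = matrix s"
  have As: "A *v x = s x" for x
    unfolding A_def using ls by (simp add: matrix_works)
  have oA: "orthogonal_matrix A"
    using os by (simp add: A_def orthogonal_transformation_matrix)
  define D :: "real^4^4" where "D = (\<chi> i j. if i = j then (if i = 2 then -1 else 1) else 0)"
  have Dv: "(D *v x) $ i = (if i = 2 then - x $ i else x $ i)" for x i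
  proof -
    have "(D *v x) $ i = (\<Sum>j\<in>UNIV. if i = j then (if i = 2 then - x $ i else x $ i) else 0)"
      unfolding D_def matrix_vector_mult_def vec_lambda_beta by (rule sum.cong) simp_all
    then show ?thesis by (simp only: sum.delta' finite UNIV_I if_True)
  qed
  have "det D = (\<Prod>i\<in>UNIV. D $ i $ i)"
    by (rule det_diagonal) (simp add: D_def)
  also have "\<dots> = (\<Prod>i\<in>(UNIV::4 set). if i = 2 then -1 else 1)"
    by (rule prod.cong) (simp_all add: D_def)
  finally have detD: "det D = -1"
    by (simp only: prod.delta finite UNIV_I if_True)
  have D4: "D *v axis 4 1 = axis 4 1" and D1: "D *v axis 1 1 = axis 1 1"
    by (simp_all add: vec_eq_iff Dv axis_def)
  have "transpose D = D"
    by (auto simp: D_def transpose_def vec_eq_iff)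
  moreover have "D ** D = mat 1"
    unfolding matrix_eq by (simp add: matrix_vector_mul_assoc[symmetric] vec_eq_iff Dv)
  ultimately have oD: "orthogonal_matrix D"
    by (simp add: orthogonal_matrix)
  show ?thesis
  proof (cases "det A = 1")
    case True
    then show ?thesis
      using oA As e4 e1 by (auto simp: rotation_matrix_def)
  next
    case False
    then have "det A = -1"
      using det_orthogonal_matrix[OF oA] by simp
    then have "rotation_matrix (D ** A)"
      by (simp add: rotation_matrix_def orthogonal_matrix_mul oA oD det_mul detD)
    moreover have "(D ** A) *v axis 4 1 = axis 4 1" "(D ** A) *v \<xi> = axis 1 1"
      by (simp_all add: matrix_vector_mul_assoc[symmetric] As e4 e1 D4 D1)
    ultimately show ?thesis by blast
  qed
qed

lemma radial_profile_eq:
  assumes K: "body_of_revolution K" and \<xi>: "norm \<xi> = 1" "\<xi> $ 4 = 0"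
  shows "radial K (sqrt (1 - t\<^sup>2) *\<^sub>R \<xi> + t *\<^sub>R axis 4 1) = radial_profile K t"
proof -
  obtain Q where Q: "rotation_matrix Q" "Q *v axis 4 1 = axis 4 1" "Q *v \<xi> = axis 1 1"
    using rotation_to_meridian[OF \<xi>] by blast
  let ?x = "sqrt (1 - t\<^sup>2) *\<^sub>R \<xi> + t *\<^sub>R axis 4 1"
  have QK: "(*v) Q ` K = K"
    using K Q by (auto simp: body_of_revolution_def)
  have "orthogonal_transformation ((*v) Q)"
    using Q(1) by (simp add: rotation_matrix_def orthogonal_transformation_matrix)
  then have inj: "inj ((*v) Q)"
    by (rule orthogonal_transformation_inj)
  have "c *\<^sub>R ?x \<in> K \<longleftrightarrow> c *\<^sub>R (Q *v ?x) \<in> K" for c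
    using inj_image_mem_iff[OF inj, of "c *\<^sub>R ?x" K] QK
    by (simp add: matrix_vector_mult_scaleR)
  moreover have "Q *v ?x = sqrt (1 - t\<^sup>2) *\<^sub>R axis 1 1 + t *\<^sub>R axis 4 1"
    using Q by (simp add: matrix_vector_right_distrib matrix_vector_mult_scaleR)
  ultimately show ?thesis
    by (simp add: radial_profile_def radial_def)
qed

end

theory Submission
  imports Defs
begin

text \<open>
  Write \<open>F r = \<integral>\<^sub>0\<^sup>r \<rho>\<^sub>K\<^sup>3\<close>.  For a unit vector \<open>w \<in> \<real>\<^sup>3\<close> put \<open>u = (w, z) / \<surd>(1 + z\<^sup>2)\<close>, a direction whose angle
  with the axis has sine \<open>r = 1 / \<surd>(1 + z\<^sup>2)\<close>.  Polar coordinates give \<open>Vol(K \<inter> u\<^sup>\<bottom>) = 4\<pi>/3 \<cdot> F r / r\<close>, so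
  if \<open>IK\<close> is the polar of a zonoid \<open>Z\<close> with measure \<open>\<mu>\<close>, then \<open>h\<^sub>Z(w, z) = \<phi> z\<close> with
  \<open>\<phi> z = 3 / (4\<pi> F((1 + z\<^sup>2)\<^sup>-\<^sup>1\<^sup>/\<^sup>2))\<close>.  As \<open>\<phi>\<close> is even and
  \<open>\<bar>x + y\<bar> + \<bar>x - y\<bar> = 2 max \<bar>x\<bar> \<bar>y\<bar>\<close>, \<open>\<phi> z\<close> is the \<open>\<mu>\<close>-integral of \<open>max \<bar>w \<bullet> p\<bar> \<bar>z q\<bar>\<close> over
  \<open>v = (p, q)\<close>.  Averaging over \<open>w\<close>, for which \<open>\<bar>w \<bullet> p\<bar>\<close> is uniform on
  \<open>[0, \<bar>p\<bar>]\<close> by Archimedes, yields \<open>\<phi>(2z) - 4\<phi>(z) + 3\<phi>(0) \<le> 0\<close>.  This combination annihilates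
  \<open>1\<close> and \<open>z\<^sup>2\<close>, and the hypothesis says that the coefficient of \<open>z\<^sup>4\<close> in the expansion of \<open>\<phi>\<close> at \<open>0\<close>,
  which is a positive multiple of \<open>2 F'(1)\<^sup>2 - F(1) (3 F'(1) + F''(1))\<close>, is positive: a contradiction.
\<close>

subsection \<open>The distribution of a component of a random direction in three-space\<close>

text \<open>Reflection exchanges left and right half-lines, which reduces the claim to
  \<open>measure_eqI_lessThan\<close>; reflecting twice restores both measures.\<close>

lemma measure_eqI_greaterThan:
  fixes M N :: "real measure"
  assumes sets: "sets M = sets borel" "sets N = sets borel"
    and fin: "\<And>x. emeasure M {..<x} < \<infinity>"
    and eq: "\<And>x. emeasure M {..<x} = emeasure N {..<x}"
  shows "M = N"
proof -
  note sets[measurable_cong]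
  have vim: "uminus -` {x<..} = {..<-x::real}" for x
    by auto
  have "distr M borel uminus = distr N borel uminus"
    by (rule measure_eqI_lessThan)
      (use sets fin eq in \<open>auto simp: emeasure_distr vim sets_eq_imp_space_eq[OF sets(1)] sets_eq_imp_space_eq[OF sets(2)]\<close>)
  then have "distr (distr M borel uminus) borel uminus = distr (distr N borel uminus) borel (uminus :: real \<Rightarrow> real)"
    by simp
  then have "distr M borel (\<lambda>x. x) = distr N borel (\<lambda>x. x)"
    by (simp add: distr_distr o_def)
  then show ?thesis
    by (simp add: distr_id2 sets)
qed

text \<open>Slice perpendicular to the axis: for \<open>\<bar>u\<bar> \<le> s * R\<close> the
  section is an annulus, possibly degenerate, of area
  \<open>pi * (R\<^sup>2 - u\<^sup>2 / s\<^sup>2)\<close>, and beyond that range it is empty. The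
  iterated product type makes this slicing an instance of Fubini.\<close>

lemma emeasure_double_cone_complement_prod:
  fixes s R :: real
  assumes s: "0 < s" "s \<le> 1" and R: "0 \<le> R"
  shows "emeasure lborel {y::real \<times> (real \<times> real). norm y < R \<and> \<bar>fst y\<bar> < s * norm y}
    = ennreal (4 * pi / 3 * s * R ^ 3)"
proof -
  let ?A = "{y::real \<times> (real \<times> real). norm y < R \<and> \<bar>fst y\<bar> < s * norm y}"
  \<comment> \<open>Squaring \<open>\<bar>u\<bar> < s * norm (u, x)\<close> and solving for
    \<open>norm x\<close> gives the squared inner radius \<open>u\<^sup>2 * q\<close>.\<close>
  define q where "q = 1 / s\<^sup>2 - 1"
  have q: "0 \<le> q"
    using s by (simp add: q_def power_le_one)
  have "open ?A"
    by (intro open_Collect_conj open_Collect_less continuous_intros)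
  then have A: "?A \<in> sets borel"
    by simp
  have slice: "emeasure lborel (Pair u -` ?A)
      = ennreal (pi * (R\<^sup>2 - u\<^sup>2 / s\<^sup>2)) * indicator {- (s * R)..s * R} u" for u :: real
  proof -
    have mem: "(u, x) \<in> ?A \<longleftrightarrow> (norm x)\<^sup>2 < R\<^sup>2 - u\<^sup>2 \<and> u\<^sup>2 * q < (norm x)\<^sup>2" for x :: "real \<times> real"
    proof -
      have n: "(norm (u, x))\<^sup>2 = u\<^sup>2 + (norm x)\<^sup>2"
        by (simp add: norm_Pair)
      have "norm (u, x) < R \<longleftrightarrow> (norm (u, x))\<^sup>2 < R\<^sup>2"
        using R by (metis norm_ge_zero pos2 power2_less_imp_less power_strict_mono)
      moreover have "\<bar>u\<bar> < s * norm (u, x) \<longleftrightarrow> \<bar>u\<bar>\<^sup>2 < (s * norm (u, x))\<^sup>2"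
        using s by (smt (verit) abs_ge_zero mult_nonneg_nonneg norm_ge_zero power2_less_imp_less power_strict_mono pos2)
      moreover have "\<bar>u\<bar>\<^sup>2 < (s * norm (u, x))\<^sup>2 \<longleftrightarrow> u\<^sup>2 * q < (norm x)\<^sup>2"
        unfolding power_mult_distrib n q_def using s by (simp add: field_simps)
      ultimately show ?thesis
        by (auto simp: n)
    qed
    show ?thesis
    proof (cases "\<bar>u\<bar> \<le> s * R")
      case True
      then have "\<bar>u\<bar>\<^sup>2 \<le> (s * R)\<^sup>2"
        by (intro power_mono) auto
      then have us: "u\<^sup>2 / s\<^sup>2 \<le> R\<^sup>2"
        using s by (simp add: field_simps power_mult_distrib)
      have uq: "u\<^sup>2 * q = u\<^sup>2 / s\<^sup>2 - u\<^sup>2"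
        by (simp add: q_def algebra_simps)
      have uq0: "0 \<le> u\<^sup>2 * q"
        using q by simp
      have R2: "u\<^sup>2 * q \<le> R\<^sup>2 - u\<^sup>2"
        using us uq by simp
      have sq: "norm x < sqrt c \<longleftrightarrow> (norm x)\<^sup>2 < c" "norm x \<le> sqrt c \<longleftrightarrow> (norm x)\<^sup>2 \<le> c" for x :: "real \<times> real" and c
        by (metis norm_ge_zero real_less_rsqrt real_sqrt_abs abs_norm_cancel real_sqrt_less_iff)
           (metis norm_ge_zero real_sqrt_abs abs_norm_cancel real_sqrt_le_iff)
      have "Pair u -` ?A = ball 0 (sqrt (R\<^sup>2 - u\<^sup>2)) - cball 0 (sqrt (u\<^sup>2 * q))"
        using mem sq by (auto simp: not_le)
      \<comment> \<open>The closed inner disc is intersected with the open outer one so that a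
        subset is subtracted: if the radii agree, the closed disc is not contained in the open
        one.\<close>
      also have "emeasure lborel \<dots> = emeasure lborel (ball (0::real \<times> real) (sqrt (R\<^sup>2 - u\<^sup>2)))
          - emeasure lborel (cball (0::real \<times> real) (sqrt (u\<^sup>2 * q)) \<inter> ball 0 (sqrt (R\<^sup>2 - u\<^sup>2)))"
        using emeasure_bounded_finite[of "cball (0::real \<times> real) (sqrt (u\<^sup>2 * q)) \<inter> ball 0 (sqrt (R\<^sup>2 - u\<^sup>2))"]
        by (subst emeasure_Diff[symmetric]) (auto simp: bounded_Int intro!: arg_cong[where f="emeasure lborel"])
      also have "emeasure lborel (cball (0::real \<times> real) (sqrt (u\<^sup>2 * q)) \<inter> ball 0 (sqrt (R\<^sup>2 - u\<^sup>2)))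
          = ennreal (pi * (u\<^sup>2 * q))"
      proof (cases "u\<^sup>2 * q = R\<^sup>2 - u\<^sup>2")
        case True
        then have "cball (0::real \<times> real) (sqrt (u\<^sup>2 * q)) \<inter> ball 0 (sqrt (R\<^sup>2 - u\<^sup>2)) = ball 0 (sqrt (u\<^sup>2 * q))"
          by auto
        then show ?thesis
          using uq0 by (simp add: emeasure_ball unit_ball_vol_2)
      next
        case False
        then have "sqrt (u\<^sup>2 * q) < sqrt (R\<^sup>2 - u\<^sup>2)"
          using R2 by simp
        then have "cball (0::real \<times> real) (sqrt (u\<^sup>2 * q)) \<inter> ball 0 (sqrt (R\<^sup>2 - u\<^sup>2)) = cball 0 (sqrt (u\<^sup>2 * q))"
          by (auto simp del: real_sqrt_less_iff)
        then show ?thesis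
          using uq0 by (simp add: emeasure_cball unit_ball_vol_2)
      qed
      also have "emeasure lborel (ball (0::real \<times> real) (sqrt (R\<^sup>2 - u\<^sup>2))) = ennreal (pi * (R\<^sup>2 - u\<^sup>2))"
        using uq0 R2 by (simp add: emeasure_ball unit_ball_vol_2)
      also have "ennreal (pi * (R\<^sup>2 - u\<^sup>2)) - ennreal (pi * (u\<^sup>2 * q)) = ennreal (pi * (R\<^sup>2 - u\<^sup>2 / s\<^sup>2))"
      proof -
        have "pi * (R\<^sup>2 - u\<^sup>2) - pi * (u\<^sup>2 * q) = pi * (R\<^sup>2 - u\<^sup>2 / s\<^sup>2)"
          unfolding uq by (simp add: algebra_simps)
        then show ?thesis
          using uq0 by (subst ennreal_minus) simp_all
      qed
      finally show ?thesis
        using True by (auto simp: indicator_def)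
    next
      case False
      then have "(s * R)\<^sup>2 < \<bar>u\<bar>\<^sup>2"
        using s R by (intro power_strict_mono) auto
      then have "R\<^sup>2 - u\<^sup>2 < u\<^sup>2 * q"
        using s by (simp add: q_def field_simps power_mult_distrib)
      then have "Pair u -` ?A = {}"
        using mem by fastforce
      moreover have "u \<notin> {- (s * R)..s * R}"
        using False by auto
      ultimately show ?thesis
        by (simp only: emeasure_empty indicator_simps mult_zero_right not_False_eq_True)
    qed
  qed
  define F where "F u = pi * (R\<^sup>2 * u - u ^ 3 / (3 * s\<^sup>2))" for u
  have "emeasure lborel ?A = emeasure (lborel \<Otimes>\<^sub>M lborel) ?A"
    by (simp add: lborel_prod)
  also have "\<dots> = (\<integral>\<^sup>+u. emeasure lborel (Pair u -` ?A) \<partial>lborel)"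
    using A by (intro lborel.emeasure_pair_measure_alt) (simp only: lborel_prod sets_lborel)
  also have "\<dots> = (\<integral>\<^sup>+u. ennreal (pi * (R\<^sup>2 - u\<^sup>2 / s\<^sup>2)) * indicator {- (s * R)..s * R} u \<partial>lborel)"
    unfolding slice ..
  also have "\<dots> = ennreal (F (s * R) - F (- (s * R)))"
  proof (rule nn_integral_FTC_Icc)
    show "(\<lambda>u. pi * (R\<^sup>2 - u\<^sup>2 / s\<^sup>2)) \<in> borel_measurable borel"
      by simp
    show "- (s * R) \<le> s * R"
      using s R by simp
  next
    fix u assume "u \<in> {- (s * R)..s * R}"
    then have "\<bar>u\<bar>\<^sup>2 \<le> (s * R)\<^sup>2"
      by (intro power_mono) auto
    then show "0 \<le> pi * (R\<^sup>2 - u\<^sup>2 / s\<^sup>2)"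
      using s by (simp add: field_simps power_mult_distrib)
    show "DERIV F u :> pi * (R\<^sup>2 - u\<^sup>2 / s\<^sup>2)"
      unfolding F_def
      using s by (auto intro!: derivative_eq_intros simp: field_simps)
  qed
  also have "F (s * R) - F (- (s * R)) = 4 * pi / 3 * s * R ^ 3"
    using s by (simp add: F_def field_simps power2_eq_square power3_eq_cube)
  finally show ?thesis .
qed

lemma emeasure_lborel_Times:
  fixes A :: "'a::euclidean_space set" and B :: "'b::euclidean_space set"
  assumes "A \<in> sets borel" "B \<in> sets borel"
  shows "emeasure lborel (A \<times> B) = emeasure lborel A * emeasure lborel B"
  unfolding lborel_prod[symmetric] using assms by (intro lborel.emeasure_pair_measure_Times) simp_all

lemma measurable_vector3:
  "(\<lambda>(u, x1, x2). vector [u, x1, x2] :: real^3) \<in> borel_measurable borel" (is "?T \<in> _")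
proof -
  have "?T = (\<lambda>y. fst y *\<^sub>R axis 1 1 + fst (snd y) *\<^sub>R axis 2 1 + snd (snd y) *\<^sub>R axis 3 1)"
    by (auto simp: fun_eq_iff vec_eq_iff forall_3 axis_def)
  then show ?thesis
    by (simp only:) (intro borel_measurable_continuous_onI continuous_intros)
qed

text \<open>The coordinate map preserves the volume of boxes, so volumes computed in the iterated
  product carry over to \<open>real^3\<close>.\<close>

lemma lborel_distr_vector3:
  "distr lborel borel (\<lambda>(u, x1, x2). vector [u, x1, x2] :: real^3) = lborel" (is "distr _ _ ?T = _")
proof (rule lborel_eqI[symmetric])
  fix l u :: "real^3" assume lu: "\<And>b. b \<in> Basis \<Longrightarrow> l \<bullet> b \<le> u \<bullet> b"
  have ax: "axis i 1 \<in> (Basis :: (real^3) set)" for i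
    by (simp add: axis_in_Basis_iff)
  have le: "l $ i \<le> u $ i" for i
    using lu[OF ax[of i]] by (simp add: inner_axis)
  have vim: "?T -` box l u = box (l $ 1) (u $ 1) \<times> (box (l $ 2) (u $ 2) \<times> box (l $ 3) (u $ 3))"
    by (auto simp: mem_box_cart forall_3)
  have "emeasure (distr lborel borel ?T) (box l u) = emeasure lborel (?T -` box l u)"
    using measurable_vector3 by (subst emeasure_distr) auto
  also have "\<dots> = ennreal (u $ 1 - l $ 1) * (ennreal (u $ 2 - l $ 2) * ennreal (u $ 3 - l $ 3))"
  proof -
    have "emeasure lborel {l $ i<..<u $ i} = ennreal (u $ i - l $ i)" for i
      using le by (rule emeasure_lborel_Ioo)
    then show ?thesis
      unfolding vim box_real
      by (simp only: emeasure_lborel_Times borel_open open_Times open_greaterThanLessThan)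
  qed
  also have "\<dots> = (\<Prod>b\<in>Basis. (u - l) \<bullet> b)"
  proof -
    have "(\<Prod>b\<in>Basis. (u - l) \<bullet> b) = (\<Prod>i\<in>UNIV. (u - l) \<bullet> axis i 1)"
      by (simp add: Basis_vec_def image_def[symmetric] UNION_singleton_eq_range prod.reindex axis_eq_axis inj_on_def)
    also have "\<dots> = (u $ 1 - l $ 1) * (u $ 2 - l $ 2) * (u $ 3 - l $ 3)"
      unfolding UNIV_3 inner_axis by simp
    finally show ?thesis
      using le[of 1] le[of 2] le[of 3]
      by (simp only: ennreal_mult[symmetric] diff_ge_0_iff_ge mult_nonneg_nonneg mult.assoc)
  qed
  finally show "emeasure (distr lborel borel ?T) (box l u) = (\<Prod>b\<in>Basis. (u - l) \<bullet> b)" .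
qed simp

text \<open>Rotation invariance of Lebesgue measure reduces a general unit vector to the first axis,
  where the product computation applies.\<close>

lemma emeasure_double_cone_complement:
  fixes a :: "real^3"
  assumes a: "norm a = 1" and s: "0 < s" "s \<le> 1" and R: "0 \<le> R"
  shows "emeasure lborel {y. norm y < R \<and> \<bar>a \<bullet> y\<bar> < s * norm y} = ennreal (4 * pi / 3 * s * R ^ 3)"
proof -
  define A where "A b = {y::real^3. norm y < R \<and> \<bar>b \<bullet> y\<bar> < s * norm y}" for b
  let ?e = "axis 1 1 :: real^3"
  let ?T = "\<lambda>(u, x1, x2). vector [u, x1, x2] :: real^3"
  have "open (A b)" for b
    unfolding A_def by (intro open_Collect_conj open_Collect_less continuous_intros)
  then have borel: "A b \<in> sets borel" for b
    by simp
  have "bounded (A b)" for b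
    by (rule bounded_subset[OF bounded_ball[of 0 R]]) (auto simp: A_def)
  then have lmeas: "A b \<in> lmeasurable" for b
    using \<open>open (A b)\<close> by (rule lmeasurable_open)
  have "?e \<bullet> ?T y = fst y" for y
    unfolding inner_axis' by (simp add: split_beta)
  moreover have "norm (?T y) = norm y" for y
    unfolding norm_eq_sqrt_inner[of "?T y"] inner_vec_def sum_3
    by (simp add: split_beta norm_prod_def power2_eq_square)
  ultimately have vim: "?T -` A ?e = {y. norm y < R \<and> \<bar>fst y\<bar> < s * norm y}"
    unfolding A_def by auto
  have "emeasure lborel (A ?e) = emeasure (distr lborel borel ?T) (A ?e)"
    by (simp add: lborel_distr_vector3)
  also have "\<dots> = emeasure lborel (?T -` A ?e)"
    using measurable_vector3 borel by (subst emeasure_distr) auto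
  also have "\<dots> = ennreal (4 * pi / 3 * s * R ^ 3)"
    unfolding vim using s R by (rule emeasure_double_cone_complement_prod)
  finally have e: "emeasure lborel (A ?e) = ennreal (4 * pi / 3 * s * R ^ 3)" .
  obtain Q where Q: "orthogonal_transformation Q" "Q ?e = a"
    using orthogonal_transformation_exists_1[of ?e a] a by auto
  have img: "A a = Q ` A ?e"
  proof (intro set_eqI iffI)
    fix y assume "y \<in> A a"
    moreover obtain x where "y = Q x"
      using orthogonal_transformation_surj[OF Q(1)] by (metis surjD)
    ultimately have "x \<in> A ?e"
      using Q unfolding A_def by (auto simp: orthogonal_transformation_norm orthogonal_transformation_def)
    then show "y \<in> Q ` A ?e"
      using \<open>y = Q x\<close> by simp
  next
    fix y assume "y \<in> Q ` A ?e"
    then show "y \<in> A a"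
      using Q unfolding A_def by (auto simp: orthogonal_transformation_norm orthogonal_transformation_def)
  qed
  have "emeasure lborel (A a) = emeasure lebesgue (A a)"
    using borel by simp
  also have "\<dots> = measure lebesgue (A a)"
    using lmeas by (rule emeasure_eq_measure2)
  also have "\<dots> = measure lebesgue (A ?e)"
    unfolding img by (simp only: measure_orthogonal_image[OF Q(1) lmeas])
  also have "\<dots> = emeasure lebesgue (A ?e)"
    by (rule emeasure_eq_measure2[OF lmeas, symmetric])
  also have "\<dots> = emeasure lborel (A ?e)"
    using borel by simp
  finally show ?thesis
    unfolding e by (simp add: A_def)
qed

lemma emeasure_distr_ball_direction:
  fixes a :: "real^3"
  assumes [measurable]: "B \<in> sets borel"
  shows "emeasure (distr (restrict_space lborel (ball 0 R)) borel (\<lambda>y. \<bar>a \<bullet> y\<bar> / norm y)) B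
    = emeasure lborel {y. norm y < R \<and> \<bar>a \<bullet> y\<bar> / norm y \<in> B}" (is "emeasure ?M B = _")
proof -
  have "emeasure ?M B = emeasure (restrict_space lborel (ball 0 R))
      ((\<lambda>y. \<bar>a \<bullet> y\<bar> / norm y) -` B \<inter> space (restrict_space lborel (ball 0 R)))"
    by (intro emeasure_distr measurable_restrict_space1) measurable
  also have "\<dots> = emeasure lborel ((\<lambda>y. \<bar>a \<bullet> y\<bar> / norm y) -` B \<inter> space (restrict_space lborel (ball 0 R)))"
    by (intro emeasure_restrict_space) (auto simp: space_restrict_space)
  also have "(\<lambda>y. \<bar>a \<bullet> y\<bar> / norm y) -` B \<inter> space (restrict_space lborel (ball 0 R))
      = {y. norm y < R \<and> \<bar>a \<bullet> y\<bar> / norm y \<in> B}"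
    by (auto simp: space_restrict_space)
  finally show ?thesis .
qed

lemma emeasure_scaled_uniform:
  fixes B :: "real set"
  assumes [measurable]: "B \<in> sets borel" and c: "0 \<le> c"
  shows "emeasure (density lborel (\<lambda>t. ennreal (c * indicator {0..1} t))) B
    = ennreal c * emeasure lborel (B \<inter> {0..1})" (is "emeasure ?N B = _")
proof -
  have "emeasure ?N B = (\<integral>\<^sup>+t. ennreal (c * indicator {0..1} t) * indicator B t \<partial>lborel)"
    by (intro emeasure_density) auto
  also have "\<dots> = (\<integral>\<^sup>+t. ennreal c * indicator (B \<inter> {0..1}) t \<partial>lborel)"
    by (intro nn_integral_cong) (simp split: split_indicator)
  also have "\<dots> = ennreal c * emeasure lborel (B \<inter> {0..1})"
    by (intro nn_integral_cmult_indicator) simp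
  finally show ?thesis .
qed

text \<open>Archimedes' hat-box theorem.\<close>

lemma distr_ball_direction:
  fixes a :: "real^3"
  assumes a: "norm a = 1" and R: "0 \<le> R"
  shows "distr (restrict_space lborel (ball 0 R)) borel (\<lambda>y. \<bar>a \<bullet> y\<bar> / norm y)
    = density lborel (\<lambda>t. ennreal (4 * pi / 3 * R ^ 3 * indicator {0..1} t))" (is "?M = ?N")
proof (rule measure_eqI_greaterThan)
  note M = emeasure_distr_ball_direction[OF borel_open[OF open_lessThan], where a = a and R = R]
  have c: "0 \<le> 4 * pi / 3 * R ^ 3"
    using R by simp
  note N = emeasure_scaled_uniform[OF borel_open[OF open_lessThan] c]
  show "sets ?M = sets borel" "sets ?N = sets borel"
    by simp_all
  fix x
  have "emeasure ?M {..<x} \<le> emeasure lborel (ball (0::real^3) R)"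
    by (subst M) (auto intro: emeasure_mono)
  also have "\<dots> < \<infinity>"
    by (intro emeasure_bounded_finite) simp
  finally show "emeasure ?M {..<x} < \<infinity>" .
  show "emeasure ?M {..<x} = emeasure ?N {..<x}"
  proof -
    consider "x \<le> 0" | "0 < x" "x \<le> 1" | "1 < x"
      by linarith
    then show ?thesis
    proof cases
      case 1
      then have e: "{y. norm y < R \<and> \<bar>a \<bullet> y\<bar> / norm y \<in> {..<x}} = {}"
        by (auto simp: not_less intro: order.trans)
      have "{..<x} \<inter> {0..1} = {}"
        using 1 by auto
      then show ?thesis
        unfolding M N e by simp
    next
      case 2
      \<comment> \<open>The two sets can differ only at the origin, where
        \<open>0 / 0 = 0 < x\<close> holds but \<open>0 < x * 0\<close> fails.\<close>
      have "emeasure lborel {y. norm y < R \<and> \<bar>a \<bullet> y\<bar> / norm y \<in> {..<x}}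
          = emeasure lborel {y. norm y < R \<and> \<bar>a \<bullet> y\<bar> < x * norm y}"
      proof (rule emeasure_eq_AE)
        show "AE y in lborel. y \<in> {y. norm y < R \<and> \<bar>a \<bullet> y\<bar> / norm y \<in> {..<x}}
            \<longleftrightarrow> y \<in> {y. norm y < R \<and> \<bar>a \<bullet> y\<bar> < x * norm y}"
          using AE_lborel_singleton[of "0::real^3"] by eventually_elim (auto simp: field_simps)
      qed measurable
      also have "\<dots> = ennreal (4 * pi / 3 * x * R ^ 3)"
        using a 2 R by (rule emeasure_double_cone_complement)
      also have "\<dots> = ennreal (4 * pi / 3 * R ^ 3) * ennreal x"
        using 2 R by (simp add: ennreal_mult[symmetric] mult_ac)
      also have "ennreal x = emeasure lborel ({..<x} \<inter> {0..1})"
      proof -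
        have "{..<x} \<inter> {0..1} = {0..<x}"
          using 2 by auto
        then show ?thesis
          using 2 by simp
      qed
      finally show ?thesis
        unfolding M N .
    next
      case 3
      have "\<bar>a \<bullet> y\<bar> / norm y < x" for y
      proof -
        have "\<bar>a \<bullet> y\<bar> \<le> norm y"
          using Cauchy_Schwarz_ineq2[of a y] a by simp
        then have "\<bar>a \<bullet> y\<bar> / norm y \<le> 1"
          by (simp add: divide_le_eq_1)
        then show ?thesis
          using 3 by simp
      qed
      then have "{y. norm y < R \<and> \<bar>a \<bullet> y\<bar> / norm y \<in> {..<x}} = ball 0 R"
        by auto
      moreover have "{..<x} \<inter> {0..1} = {0..1}"
        using 3 by auto
      ultimately show ?thesis
        unfolding M N using R by (simp add: emeasure_ball unit_ball_vol_3)
    qed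
  qed
qed

corollary emeasure_ball_direction:
  fixes a :: "real^3"
  assumes a: "norm a = 1" and R: "0 \<le> R" and B: "B \<in> sets borel"
  shows "emeasure lborel {y. norm y < R \<and> \<bar>a \<bullet> y\<bar> / norm y \<in> B}
    = ennreal (4 * pi / 3 * R ^ 3) * emeasure lborel (B \<inter> {0..1})"
  unfolding emeasure_distr_ball_direction[OF B, symmetric] distr_ball_direction[OF a R]
  using B R by (intro emeasure_scaled_uniform) auto

text \<open>Integration in polar coordinates: the radius and the quotient
  \<open>\<bar>a \<bullet> y\<bar> / norm y\<close> are independent, their joint law being the
  product of the law \<open>\<nu>\<close> of the radius and the uniform law \<open>U\<close>. Fubini
  over the region under the graph of \<open>g\<close> then adds up volumes of balls of radius
  \<open>g t\<close>.\<close>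

lemma emeasure_polar_subgraph:
  fixes a :: "real^3"
  assumes a: "norm a = 1" and g[measurable]: "g \<in> borel_measurable borel" and g0: "\<And>t. 0 \<le> g t"
  shows "emeasure lborel {y. norm y \<le> g (\<bar>a \<bullet> y\<bar> / norm y)}
    = (\<integral>\<^sup>+t. ennreal (4 * pi / 3 * g t ^ 3) * indicator {0..1} t \<partial>lborel)"
proof -
  define \<nu> where "\<nu> = distr (lborel :: (real^3) measure) borel norm"
  define U where "U = density lborel (indicator {0..1::real})"
  let ?P = "\<lambda>y::real^3. (norm y, \<bar>a \<bullet> y\<bar> / norm y)"
  have [simp]: "sets \<nu> = sets borel" "sets U = sets borel" "space \<nu> = UNIV" "space U = UNIV"
    by (simp_all add: \<nu>_def U_def)
  note [measurable_cong] = \<open>sets \<nu> = sets borel\<close> \<open>sets U = sets borel\<close>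
  have U: "emeasure U B = emeasure lborel (B \<inter> {0..1})" if [measurable]: "B \<in> sets borel" for B
  proof -
    have "emeasure U B = (\<integral>\<^sup>+t. indicator {0..1} t * indicator B t \<partial>lborel)"
      unfolding U_def by (intro emeasure_density) auto
    also have "\<dots> = (\<integral>\<^sup>+t. indicator (B \<inter> {0..1}) t \<partial>lborel)"
      by (intro nn_integral_cong) (simp split: split_indicator)
    finally show ?thesis
      by simp
  qed
  have \<nu>: "emeasure \<nu> A = emeasure lborel (norm -` A :: (real^3) set)" if "A \<in> sets borel" for A
    unfolding \<nu>_def using that by (subst emeasure_distr) auto
  have \<nu>ball: "emeasure \<nu> {..<x} = ennreal (4 * pi / 3 * max 0 x ^ 3)" for x
  proof -
    have "(norm -` {..<x} :: (real^3) set) = ball 0 (max 0 x)"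
      by (auto simp: less_max_iff_disj)
    then show ?thesis
      by (simp add: \<nu> emeasure_ball unit_ball_vol_3)
  qed
  have "finite_measure U"
    by (rule finite_measureI) (simp add: U)
  then interpret U: finite_measure U .
  have "sigma_finite_measure \<nu>"
  proof
    show "\<exists>A. countable A \<and> A \<subseteq> sets \<nu> \<and> \<Union> A = space \<nu> \<and> (\<forall>a\<in>A. emeasure \<nu> a \<noteq> \<infinity>)"
      by (intro exI[of _ "range (\<lambda>n::nat. {..<real n})"]) (auto simp: \<nu>ball reals_Archimedean2)
  qed
  then interpret \<nu>: sigma_finite_measure \<nu> .
  have prod: "\<nu> \<Otimes>\<^sub>M U = distr lborel (borel \<Otimes>\<^sub>M borel) ?P"
  proof (rule pair_measure_eqI)
    fix A B assume "A \<in> sets \<nu>" "B \<in> sets U"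
    then have [measurable]: "A \<in> sets borel" "B \<in> sets borel"
      by simp_all
    have [measurable]: "{y. \<bar>a \<bullet> y\<bar> / norm y \<in> B} \<in> sets borel"
      by measurable
    \<comment> \<open>For fixed \<open>B\<close> both sides of the product formula are measures in
      \<open>A\<close>. They agree on half-lines by \<open>emeasure_ball_direction\<close>, and
      half-lines determine them.\<close>
    define M where "M = distr (restrict_space lborel {y. \<bar>a \<bullet> y\<bar> / norm y \<in> B}) borel norm"
    have M: "emeasure M A = emeasure lborel {y. norm y \<in> A \<and> \<bar>a \<bullet> y\<bar> / norm y \<in> B}"
      if [measurable]: "A \<in> sets borel" for A
    proof -
      let ?S = "restrict_space lborel {y. \<bar>a \<bullet> y\<bar> / norm y \<in> B}"
      have "emeasure M A = emeasure ?S (norm -` A \<inter> space ?S)"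
        unfolding M_def by (intro emeasure_distr measurable_restrict_space1) measurable
      also have "\<dots> = emeasure lborel (norm -` A \<inter> space ?S)"
        by (intro emeasure_restrict_space) (auto simp: space_restrict_space)
      also have "norm -` A \<inter> space ?S = {y. norm y \<in> A \<and> \<bar>a \<bullet> y\<bar> / norm y \<in> B}"
        by (auto simp: space_restrict_space)
      finally show ?thesis .
    qed
    define N where "N = density \<nu> (\<lambda>_. emeasure U B)"
    have N: "emeasure N A = emeasure U B * emeasure \<nu> A" if "A \<in> sets borel" for A
      unfolding N_def using that by (subst emeasure_density) (auto simp: nn_integral_cmult_indicator)
    have eq: "emeasure M {..<x} = emeasure N {..<x}" for x
    proof -
      \<comment> \<open>The ball formula requires a nonnegative radius; for \<open>x \<le> 0\<close>
        both sets are empty.\<close>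
      have "{y. norm y \<in> {..<x} \<and> \<bar>a \<bullet> y\<bar> / norm y \<in> B} = {y. norm y < max 0 x \<and> \<bar>a \<bullet> y\<bar> / norm y \<in> B}"
        by (auto simp: less_max_iff_disj)
      then show ?thesis
        by (simp add: M N \<nu>ball emeasure_ball_direction[OF a] U mult.commute)
    qed
    have "M = N"
    proof (rule measure_eqI_greaterThan)
      show "sets M = sets borel" "sets N = sets borel"
        by (simp_all add: M_def N_def)
      show "emeasure M {..<x} < \<infinity>" for x
        unfolding eq by (simp add: N \<nu>ball ennreal_mult_less_top U.emeasure_eq_measure)
      show "emeasure M {..<x} = emeasure N {..<x}" for x
        by (rule eq)
    qed
    then have "emeasure U B * emeasure \<nu> A = emeasure lborel {y. norm y \<in> A \<and> \<bar>a \<bullet> y\<bar> / norm y \<in> B}"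
      using M[of A] N[of A] by simp
    also have "\<dots> = emeasure (distr lborel (borel \<Otimes>\<^sub>M borel) ?P) (A \<times> B)"
      by (subst emeasure_distr) (auto intro!: arg_cong[where f="emeasure lborel"])
    finally show "emeasure \<nu> A * emeasure U B = emeasure (distr lborel (borel \<Otimes>\<^sub>M borel) ?P) (A \<times> B)"
      by (simp add: mult.commute)
  next
    show "sets (\<nu> \<Otimes>\<^sub>M U) = sets (distr lborel (borel \<Otimes>\<^sub>M borel) ?P)"
      unfolding sets_distr by (rule sets_pair_measure_cong) simp_all
  qed (fact \<nu>.sigma_finite_measure_axioms U.sigma_finite_measure_axioms)+
  let ?G = "{p. fst p \<le> g (snd p)}"
  have G[measurable]: "?G \<in> sets (borel \<Otimes>\<^sub>M borel)"
  proof -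
    have "{p \<in> space (borel \<Otimes>\<^sub>M borel). fst p \<le> g (snd p)} \<in> sets (borel \<Otimes>\<^sub>M borel)"
      by measurable
    then show ?thesis
      by (simp add: space_pair_measure)
  qed
  interpret pair_sigma_finite \<nu> U ..
  have "{y. norm y \<le> g (\<bar>a \<bullet> y\<bar> / norm y)} = ?P -` ?G"
    by auto
  then have "emeasure lborel {y. norm y \<le> g (\<bar>a \<bullet> y\<bar> / norm y)} = emeasure (\<nu> \<Otimes>\<^sub>M U) ?G"
    unfolding prod by (subst emeasure_distr) auto
  also have "\<dots> = (\<integral>\<^sup>+t. emeasure \<nu> ((\<lambda>x. (x, t)) -` ?G) \<partial>U)"
    using G by (intro emeasure_pair_measure_alt2) (simp only: sets_pair_measure_cong[OF \<open>sets \<nu> = sets borel\<close> \<open>sets U = sets borel\<close>])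
  also have "\<dots> = (\<integral>\<^sup>+t. ennreal (4 * pi / 3 * g t ^ 3) \<partial>U)"
  proof (rule nn_integral_cong)
    fix t
    have "(norm -` {..g t} :: (real^3) set) = cball 0 (g t)"
      by auto
    moreover have "(\<lambda>x. (x, t)) -` ?G = {..g t}"
      by auto
    ultimately show "emeasure \<nu> ((\<lambda>x. (x, t)) -` ?G) = ennreal (4 * pi / 3 * g t ^ 3)"
      using g0[of t] by (simp add: \<nu> emeasure_cball unit_ball_vol_3)
  qed
  also have "\<dots> = (\<integral>\<^sup>+t. ennreal (4 * pi / 3 * g t ^ 3) * indicator {0..1} t \<partial>lborel)"
    unfolding U_def by (subst nn_integral_density) (auto simp: mult.commute)
  finally show ?thesis .
qed

subsection \<open>An averaging inequality\<close>

text \<open>The one-sided parabola is differentiable even at its kink, so multiples of it are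
  antiderivatives of positive parts without splitting the interval.\<close>

lemma DERIV_power2_max_0: "((\<lambda>x. (max x 0)\<^sup>2) has_real_derivative 2 * max x 0) (at x)"
proof -
  consider "x < 0" | "x = 0" | "0 < x"
    by linarith
  then show ?thesis
  proof cases
    case 1
    have "((\<lambda>x. 0) has_real_derivative 2 * max x 0) (at x)"
      using 1 by simp
    then show ?thesis
      by (rule has_field_derivative_transform_within_open[of _ _ _ "{..<0}"]) (use 1 in auto)
  next
    case 2
    have "((\<lambda>h::real. (max h 0)\<^sup>2 / h) \<longlongrightarrow> 0) (at 0)"
    proof (rule Lim_null_comparison)
      show "\<forall>\<^sub>F h::real in at 0. norm ((max h 0)\<^sup>2 / h) \<le> \<bar>h\<bar>"
        by (rule always_eventually) (auto simp: max_def power2_eq_square)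
      show "((\<lambda>h::real. \<bar>h\<bar>) \<longlongrightarrow> 0) (at 0)"
        by (intro tendsto_eq_intros | simp)+
    qed
    then show ?thesis
      using 2 by (simp add: DERIV_def)
  next
    case 3
    have "((\<lambda>x. x\<^sup>2) has_real_derivative 2 * max x 0) (at x)"
      using 3 by (auto intro!: derivative_eq_intros)
    then show ?thesis
      by (rule has_field_derivative_transform_within_open[of _ _ _ "{0<..}"]) (use 3 in auto)
  qed
qed

text \<open>By \<open>max x y = x + max (y - x) 0\<close> the linear terms cancel, since 1 - 4 + 3 =
  0, and \<open>max (2 * b - t * P) 0 - 4 * max (b - t * P) 0\<close> remains. This may change sign
  in \<open>t\<close>; only its integral has a definite sign.\<close>

lemma integral_max_second_difference_nonpos:
  fixes P b :: real
  assumes P: "0 \<le> P" and b: "0 \<le> b"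
  shows "(\<integral>t. indicator {0..1} t *\<^sub>R (max (t * P) (2 * b) - 4 * max (t * P) b + 3 * (t * P)) \<partial>lborel) \<le> 0"
proof (cases "P = 0")
  case True
  then show ?thesis
    using b by (simp add: max_def)
next
  case False
  define E where "E t = (2 * (max (b - t * P) 0)\<^sup>2 - (max (2 * b - t * P) 0)\<^sup>2 / 2) / P" for t
  have "(\<integral>t. indicator {0..1} t *\<^sub>R (max (t * P) (2 * b) - 4 * max (t * P) b + 3 * (t * P)) \<partial>lborel) = E 1 - E 0"
  proof (rule integral_FTC_Icc)
    show "continuous_on {0..1} (\<lambda>t. max (t * P) (2 * b) - 4 * max (t * P) b + 3 * (t * P))"
      by (intro continuous_intros)
    fix t :: real
    have "(E has_real_derivative (2 * (2 * max (b - t * P) 0 * (- P)) - (2 * max (2 * b - t * P) 0 * (- P)) / 2) / P) (at t)"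
      unfolding E_def
      by (rule derivative_eq_intros DERIV_chain2[where f = "\<lambda>x. (max x 0)\<^sup>2", OF DERIV_power2_max_0] refl | use False in simp)+
    also have "(2 * (2 * max (b - t * P) 0 * (- P)) - (2 * max (2 * b - t * P) 0 * (- P)) / 2) / P
        = max (2 * b - t * P) 0 - 4 * max (b - t * P) 0"
      using False by (simp add: field_simps)
    also have "\<dots> = max (t * P) (2 * b) - 4 * max (t * P) b + 3 * (t * P)"
      by (simp add: max_def)
    finally show "(E has_vector_derivative max (t * P) (2 * b) - 4 * max (t * P) b + 3 * (t * P)) (at t within {0..1})"
      by (simp add: has_real_derivative_iff_has_vector_derivative has_vector_derivative_at_within)
  qed simp
  \<comment> \<open>At 0 the squares cancel since
    \<open>2 * b\<^sup>2 = (2 * b)\<^sup>2 / 2\<close>; at 1 the sign comes from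
    \<open>2 * (b - P) \<le> 2 * b - P\<close>.\<close>
  also have "E 0 = 0"
    using b by (simp add: E_def power_mult_distrib)
  also have "(2 * max (b - P) 0)\<^sup>2 \<le> (max (2 * b - P) 0)\<^sup>2"
    using P by (intro power_mono) (auto simp: max_def)
  then have "E 1 - 0 \<le> 0"
    using P False unfolding E_def diff_0_right by (intro divide_nonpos_nonneg) (auto simp: power_mult_distrib)
  finally show ?thesis .
qed

text \<open>Scaling by \<open>norm p\<close> and the hat-box law turn the ball integral into
  \<open>4 * pi / 3\<close> times the one-dimensional integral treated before.\<close>

lemma integral_ball_second_difference_nonpos:
  fixes p :: "real^3"
  assumes b: "0 \<le> b"
  shows "(\<integral>y. max (\<bar>p \<bullet> y\<bar> / norm y) (2 * b) - 4 * max (\<bar>p \<bullet> y\<bar> / norm y) b + 3 * (\<bar>p \<bullet> y\<bar> / norm y)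
    \<partial>restrict_space lborel (ball 0 1)) \<le> 0"
proof -
  obtain a where a: "norm a = 1" and p: "p = norm p *\<^sub>R a"
  proof (cases "p = 0")
    case True
    then show ?thesis
      using that[of "axis 1 1"] by simp
  next
    case False
    then show ?thesis
      using that[of "p /\<^sub>R norm p"] by simp
  qed
  define k where "k t = max (t * norm p) (2 * b) - 4 * max (t * norm p) b + 3 * (t * norm p)" for t
  have [measurable]: "k \<in> borel_measurable borel"
    unfolding k_def by measurable
  have "\<bar>p \<bullet> y\<bar> / norm y = \<bar>a \<bullet> y\<bar> / norm y * norm p" for y
    by (subst p) (simp add: abs_mult)
  then have "(\<integral>y. max (\<bar>p \<bullet> y\<bar> / norm y) (2 * b) - 4 * max (\<bar>p \<bullet> y\<bar> / norm y) b + 3 * (\<bar>p \<bullet> y\<bar> / norm y)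
      \<partial>restrict_space lborel (ball 0 1)) = (\<integral>y. k (\<bar>a \<bullet> y\<bar> / norm y) \<partial>restrict_space lborel (ball 0 1))"
    by (simp only: k_def)
  also have "\<dots> = (\<integral>t. k t \<partial>distr (restrict_space lborel (ball 0 1)) borel (\<lambda>y. \<bar>a \<bullet> y\<bar> / norm y))"
    by (subst integral_distr) (auto intro!: measurable_restrict_space1)
  also have "\<dots> = (\<integral>t. (4 * pi / 3 * indicator {0..1} t) *\<^sub>R k t \<partial>lborel)"
    unfolding distr_ball_direction[OF a zero_le_one] by (subst integral_density) auto
  also have "\<dots> = 4 * pi / 3 * (\<integral>t. indicator {0..1} t *\<^sub>R k t \<partial>lborel)"
    by (subst integral_mult_right_zero[symmetric]) (simp add: mult_ac)
  also have "\<dots> \<le> 0"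
    unfolding k_def using integral_max_second_difference_nonpos[OF norm_ge_zero b]
    by (intro mult_nonneg_nonpos) auto
  finally show ?thesis .
qed

subsection \<open>Sections of bodies of revolution\<close>

text \<open>The origin is the midpoint of an interior point and its reflection, hence interior by
  convexity.\<close>

lemma symmetric_convex_body_interior:
  fixes K :: "'a::euclidean_space set"
  assumes K: "convex_body K" and sym: "origin_symmetric K"
  shows "0 \<in> interior K"
proof -
  obtain x where x: "x \<in> interior K"
    using K by (auto simp: convex_body_def)
  then have "- x \<in> K"
    using sym interior_subset by (auto simp: origin_symmetric_def)
  then have "- x - (1 / 2) *\<^sub>R (- x - x) \<in> interior K"
    using K x by (intro mem_interior_convex_shrink) (auto simp: convex_body_def)
  moreover have "- x - (1 / 2) *\<^sub>R (- x - x) = 0"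
    by (simp add: algebra_simps flip: scaleR_2)
  ultimately show ?thesis
    by simp
qed

context
  fixes K :: "'a::euclidean_space set"
  assumes K: "compact K" "convex K" and 0: "0 \<in> interior K"
begin

lemma radial_segment_bdd:
  assumes "x \<noteq> 0"
  shows "bdd_above {c. 0 \<le> c \<and> c *\<^sub>R x \<in> K}"
proof -
  obtain B where B: "\<And>y. y \<in> K \<Longrightarrow> norm y \<le> B"
    using compact_imp_bounded[OF K(1)] by (auto simp: bounded_iff)
  show ?thesis
  proof (rule bdd_aboveI[of _ "B / norm x"])
    fix c assume "c \<in> {c. 0 \<le> c \<and> c *\<^sub>R x \<in> K}"
    then show "c \<le> B / norm x"
      using B[of "c *\<^sub>R x"] assms by (simp add: pos_le_divide_eq)
  qed
qed

text \<open>The supremum is attained because \<open>K\<close> is closed, and \<open>K\<close> is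
  star-shaped about the origin by convexity. Inequalities for the radial function thus become
  membership in \<open>K\<close>.\<close>

lemma le_radial_iff:
  assumes x: "x \<noteq> 0" and c: "0 \<le> c"
  shows "c \<le> radial K x \<longleftrightarrow> c *\<^sub>R x \<in> K"
proof -
  let ?S = "{c. 0 \<le> c \<and> c *\<^sub>R x \<in> K}"
  have "?S = {0..} \<inter> (\<lambda>c. c *\<^sub>R x) -` K"
    by auto
  moreover have "closed ((\<lambda>c. c *\<^sub>R x) -` K)"
    using K by (intro closed_vimage compact_imp_closed continuous_intros) auto
  ultimately have "closed ?S"
    by auto
  moreover have "0 \<in> ?S"
    using 0 interior_subset by auto
  ultimately have mem: "radial K x \<in> ?S"
    unfolding radial_def using radial_segment_bdd[OF x] by (intro closed_contains_Sup) auto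
  show ?thesis
  proof
    assume le: "c \<le> radial K x"
    show "c *\<^sub>R x \<in> K"
    proof (cases "c = 0")
      case True
      then show ?thesis
        using \<open>0 \<in> ?S\<close> by simp
    next
      case False
      then have pos: "0 < radial K x"
        using le c by simp
      have "(c / radial K x) *\<^sub>R (radial K x *\<^sub>R x) + (1 - c / radial K x) *\<^sub>R 0 \<in> K"
        using K(2) mem 0 interior_subset le c pos
        by (intro convexD) (auto simp: subset_iff)
      then show ?thesis
        using pos by simp
    qed
  next
    assume "c *\<^sub>R x \<in> K"
    then show "c \<le> radial K x"
      unfolding radial_def using c radial_segment_bdd[OF x] by (intro cSup_upper) auto
  qed
qed

lemma radial_pos:
  assumes x: "x \<noteq> 0"
  shows "0 < radial K x"
proof -
  obtain e where e: "0 < e" "ball 0 e \<subseteq> K"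
    using 0 mem_interior by blast
  have "(e / (2 * norm x)) *\<^sub>R x \<in> K"
    using e x by (intro subsetD[OF e(2)]) simp
  then have "e / (2 * norm x) \<le> radial K x"
    using e x by (subst le_radial_iff) auto
  then show ?thesis
    using e x by (smt (verit) divide_pos_pos zero_less_norm_iff)
qed

end

section \<open>The radial profile along a meridian\<close>

definition meridian :: "real \<Rightarrow> real^4" where
  "meridian t = sqrt (1 - t\<^sup>2) *\<^sub>R axis 1 1 + t *\<^sub>R axis 4 1"

lemma meridian_nth: "meridian t $ 1 = sqrt (1 - t\<^sup>2)" "meridian t $ 4 = t"
  by (simp_all add: meridian_def axis_def)

text \<open>Covering also \<open>\<bar>t\<bar> > 1\<close>, where \<open>meridian t\<close> is no
  longer a unit vector, makes positivity and measurability of the profile available on the whole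
  line.\<close>

lemma meridian_nonzero: "meridian t \<noteq> 0"
proof
  assume "meridian t = 0"
  then have "meridian t $ 1 = 0" "meridian t $ 4 = 0"
    by simp_all
  then show False
    by (simp add: meridian_nth)
qed

lemma norm_meridian:
  assumes "\<bar>t\<bar> \<le> 1"
  shows "norm (meridian t) = 1"
proof -
  have "axis 4 1 \<bullet> (axis 1 1 :: real^4) = 0" "axis 1 1 \<bullet> (axis 4 1 :: real^4) = 0"
    by (simp_all add: inner_axis_axis)
  moreover have "t\<^sup>2 \<le> 1"
    using assms by (simp add: abs_square_le_1)
  ultimately have "meridian t \<bullet> meridian t = 1"
    by (simp add: meridian_def inner_add_left inner_add_right inner_axis_axis flip: power2_eq_square)
  then show ?thesis
    by (simp add: norm_eq_1)
qed

lemma continuous_meridian: "continuous_on UNIV meridian"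
  unfolding meridian_def by (intro continuous_intros)

lemma radial_profile_meridian: "radial_profile K t = radial K (meridian t)"
  by (simp add: radial_profile_def meridian_def)

locale symmetric_revolution_body =
  fixes K :: "(real^4) set"
  assumes body: "convex_body K" and sym: "origin_symmetric K" and revolution: "body_of_revolution K"
begin

lemma compact_K: "compact K" and convex_K: "convex K" and zero_interior: "0 \<in> interior K"
  using body symmetric_convex_body_interior[OF body sym] by (auto simp: convex_body_def)

lemmas le_radial = le_radial_iff[OF compact_K convex_K zero_interior]

abbreviation "\<rho> \<equiv> radial_profile K"

lemma profile_pos: "0 < \<rho> t"
  unfolding radial_profile_meridian
  by (rule radial_pos[OF compact_K convex_K zero_interior meridian_nonzero])

text \<open>For \<open>c > 0\<close> the superlevel set is the preimage of the closed set
  \<open>K\<close> under the continuous curve \<open>c *\<^sub>R meridian t\<close>, hence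
  closed.\<close>

lemma measurable_profile[measurable]: "\<rho> \<in> borel_measurable borel"
  unfolding borel_measurable_iff_ge
proof
  fix c :: real
  show "{t \<in> space borel. c \<le> \<rho> t} \<in> sets borel"
  proof (cases "c \<le> 0")
    case True
    then have "{t \<in> space borel. c \<le> \<rho> t} = UNIV"
      using profile_pos by (auto intro: order.trans less_imp_le)
    then show ?thesis
      by simp
  next
    case False
    then have "{t \<in> space borel. c \<le> \<rho> t} = (\<lambda>t. c *\<^sub>R meridian t) -` K"
      unfolding radial_profile_meridian by (auto simp: le_radial meridian_nonzero)
    moreover have "closed ((\<lambda>t. c *\<^sub>R meridian t) -` K)"
      using compact_K continuous_meridian
      by (intro closed_vimage compact_imp_closed continuous_intros) auto
    ultimately show ?thesis
      by simp
  qed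
qed

lemma profile_bounded:
  obtains B where "\<And>t. \<bar>t\<bar> \<le> 1 \<Longrightarrow> \<rho> t \<le> B"
proof -
  obtain B where B: "\<And>y. y \<in> K \<Longrightarrow> norm y \<le> B"
    using compact_imp_bounded[OF compact_K] by (auto simp: bounded_iff)
  have "\<rho> t \<le> B" if "\<bar>t\<bar> \<le> 1" for t
  proof -
    have "\<rho> t *\<^sub>R meridian t \<in> K"
      using le_radial[OF meridian_nonzero[of t], of "\<rho> t"] profile_pos[of t]
      by (simp add: radial_profile_meridian)
    from B[OF this] show ?thesis
      using that profile_pos[of t] by (simp add: norm_meridian)
  qed
  then show ?thesis
    using that by blast
qed

text \<open>Central reflection reverses both the axial and the equatorial component, and the
  equatorial direction is immaterial by \<open>radial_profile_eq\<close>.\<close>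

lemma profile_uminus: "\<rho> (- t) = \<rho> t"
proof -
  have "- x \<in> K \<longleftrightarrow> x \<in> K" for x
    using sym unfolding origin_symmetric_def by (metis minus_minus)
  then have m: "radial K (- x) = radial K x" for x
    by (simp add: radial_def)
  have "\<rho> (- t) = radial K (- (sqrt (1 - (- t)\<^sup>2) *\<^sub>R axis 1 1 + (- t) *\<^sub>R axis 4 1))"
    by (simp only: m radial_profile_def)
  also have "\<dots> = radial K (sqrt (1 - t\<^sup>2) *\<^sub>R (- axis 1 1) + t *\<^sub>R axis 4 1)"
    by simp
  also have "\<dots> = \<rho> t"
    by (rule radial_profile_eq[OF revolution], simp, simp add: axis_def)
  finally show ?thesis .
qed

lemma profile_abs: "\<rho> \<bar>t\<bar> = \<rho> t"
  by (simp add: abs_if profile_uminus)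

lemma radial_eq_profile:
  assumes x: "norm x = 1"
  shows "radial K x = \<rho> (x $ 4)"
proof -
  define y where "y = x - (x $ 4) *\<^sub>R axis 4 1"
  have y4: "y $ 4 = 0"
    by (simp add: y_def axis_def)
  have "y \<bullet> y = x \<bullet> x - (x $ 4)\<^sup>2"
    by (simp add: y_def inner_diff_left inner_diff_right inner_axis inner_axis' inner_axis_axis power2_eq_square)
  then have ny: "(norm y)\<^sup>2 = 1 - (x $ 4)\<^sup>2"
    using x by (simp add: power2_norm_eq_inner norm_eq_1)
  then have n: "norm y = sqrt (1 - (x $ 4)\<^sup>2)"
    by (metis norm_ge_zero real_sqrt_unique)
  obtain \<xi> where \<xi>: "norm \<xi> = 1" "\<xi> $ 4 = 0" "y = norm y *\<^sub>R \<xi>"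
  proof (cases "y = 0")
    case True
    moreover have "(axis 1 1 :: real^4) $ 4 = 0"
      by (simp add: axis_def)
    ultimately show ?thesis
      using that[of "axis 1 1"] by simp
  next
    case False
    then show ?thesis
      using that[of "y /\<^sub>R norm y"] y4 by simp
  qed
  have "x = sqrt (1 - (x $ 4)\<^sup>2) *\<^sub>R \<xi> + (x $ 4) *\<^sub>R axis 4 1"
    using \<xi>(3) unfolding n by (simp add: y_def algebra_simps)
  then show ?thesis
    using radial_profile_eq[OF revolution \<xi>(1,2), of "x $ 4"] by simp
qed

lemma integrable_profile_power:
  assumes "- 1 \<le> c" "d \<le> 1"
  shows "(\<lambda>t. \<rho> t ^ n) integrable_on {c..d}"
proof -
  obtain B where B: "\<And>t. \<bar>t\<bar> \<le> 1 \<Longrightarrow> \<rho> t \<le> B"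
    using profile_bounded by blast
  have "integrable lborel (\<lambda>t. indicator {c..d} t *\<^sub>R \<rho> t ^ n)"
  proof (rule integrableI_bounded_set_indicator[where B = "B ^ n"])
    show "AE t in lborel. t \<in> {c..d} \<longrightarrow> norm (\<rho> t ^ n) \<le> B ^ n"
      using assms B profile_pos by (auto simp: norm_power less_imp_le intro!: power_mono AE_I2)
    show "emeasure lborel {c..d} < \<infinity>"
      by (intro emeasure_bounded_finite) simp
  qed auto
  then show ?thesis
    by (intro set_borel_integral_eq_integral(1)) (simp add: set_integrable_def)
qed

text \<open>An isometry moves the section into \<open>real^3\<close>. There a direction with cosine
  \<open>t\<close> against a suitable unit vector \<open>a\<close> has cosine \<open>r * t\<close>
  against the axis of revolution, so \<open>emeasure_polar_subgraph\<close> computes the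
  volume.\<close>

lemma section_volume_revolution:
  assumes \<xi>: "norm \<xi> = 1" and r: "0 < r" "r\<^sup>2 = 1 - (\<xi> $ 4)\<^sup>2"
  shows "section_volume K \<xi> = 4 * pi / 3 * integral {0..r} (\<lambda>t. \<rho> t ^ 3) / r"
proof -
  have "\<xi> \<noteq> 0"
    using \<xi> by auto
  obtain f where f: "hyperplane_isometry \<xi> f"
    using hyperplane_isometry_exists[OF \<open>\<xi> \<noteq> 0\<close>] by blast
  then have lf: "linear f" and nf: "\<And>y. norm (f y) = norm y" and rf: "range f = {x. \<xi> \<bullet> x = 0}"
    by (auto simp: hyperplane_isometry_def)
  have inner_f: "f x \<bullet> f y = x \<bullet> y" for x y
    using lf nf by (simp add: orthogonal_transformation_def dot_norm linear_add[symmetric])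
  \<comment> \<open>This is the orthogonal projection of the axis onto the hyperplane. Its length is
    the sine \<open>r\<close>, and its preimage \<open>b\<close> reads off the height:
    \<open>f y $ 4 = b \<bullet> y\<close>.\<close>
  let ?p = "axis 4 1 - (\<xi> $ 4) *\<^sub>R \<xi>"
  have "\<xi> \<bullet> ?p = 0"
    using \<xi> by (simp add: inner_diff_right inner_axis norm_eq_1)
  then obtain b where b: "f b = ?p"
    using rf by (metis (mono_tags, lifting) mem_Collect_eq rangeE)
  have "?p \<bullet> ?p = 1 - (\<xi> $ 4)\<^sup>2"
    using \<xi> by (simp add: inner_diff_left inner_diff_right inner_axis inner_axis' inner_axis_axis norm_eq_1 power2_eq_square)
  then have "(norm b)\<^sup>2 = r\<^sup>2"
    by (simp add: r(2) power2_norm_eq_inner inner_f[symmetric] b)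
  then have nb: "norm b = r"
    using r(1) by simp
  have f4: "f y $ 4 = b \<bullet> y" for y
  proof -
    have "\<xi> \<bullet> f y = 0"
      using rf by auto
    then have "?p \<bullet> f y = f y $ 4"
      by (simp add: inner_diff_left inner_axis')
    then show ?thesis
      by (simp add: inner_f[symmetric] b)
  qed
  define a where "a = b /\<^sub>R r"
  have a: "norm a = 1" and ba: "b = r *\<^sub>R a"
    using nb r(1) by (simp_all add: a_def)
  have r1: "r \<le> 1"
  proof (rule power2_le_imp_le)
    show "r\<^sup>2 \<le> 1\<^sup>2"
      unfolding r(2) by simp
  qed simp
  define g where "g t = \<rho> (r * t)" for t
  have vim: "f -` (K \<inter> {x. \<xi> \<bullet> x = 0}) = {y. norm y \<le> g (\<bar>a \<bullet> y\<bar> / norm y)}"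
  proof (intro set_eqI)
    fix y
    have "f y \<in> K \<longleftrightarrow> norm y \<le> g (\<bar>a \<bullet> y\<bar> / norm y)"
    proof (cases "y = 0")
      case True
      moreover have "0 \<in> K"
        using zero_interior interior_subset by blast
      ultimately show ?thesis
        using linear_0[OF lf] profile_pos[of "r * (\<bar>a \<bullet> y\<bar> / norm y)"] by (simp add: g_def)
    next
      case False
      let ?x = "f y /\<^sub>R norm y"
      have x: "norm ?x = 1"
        using False by (simp add: nf)
      have "f y \<in> K \<longleftrightarrow> norm y *\<^sub>R ?x \<in> K"
        using False by simp
      also have "\<dots> \<longleftrightarrow> norm y \<le> radial K ?x"
        using x by (intro le_radial[symmetric]) auto
      also have "radial K ?x = \<rho> (?x $ 4)"
        using x by (rule radial_eq_profile)
      also have "\<dots> = \<rho> \<bar>?x $ 4\<bar>"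
        by (rule profile_abs[symmetric])
      also have "\<bar>?x $ 4\<bar> = r * (\<bar>a \<bullet> y\<bar> / norm y)"
        using r(1) by (simp add: f4 ba abs_mult divide_inverse)
      finally show ?thesis
        by (simp add: g_def)
    qed
    then show "y \<in> f -` (K \<inter> {x. \<xi> \<bullet> x = 0}) \<longleftrightarrow> y \<in> {y. norm y \<le> g (\<bar>a \<bullet> y\<bar> / norm y)}"
      using rf by auto
  qed
  have g[measurable]: "g \<in> borel_measurable borel"
    unfolding g_def by measurable
  define I where "I = integral {0..r} (\<lambda>t. \<rho> t ^ 3)"
  have "((\<lambda>t. \<rho> t ^ 3) has_integral I) {0..r}"
    unfolding I_def using r1 by (intro integrable_integral integrable_profile_power) auto
  \<comment> \<open>The substitution of \<open>r * t\<close> for \<open>t\<close> produces the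
    division by \<open>r\<close>.\<close>
  from has_integral_stretch_real[OF this, of r] have "((\<lambda>t. g t ^ 3) has_integral I / r) ((\<lambda>x. x / r) ` {0..r})"
    using r(1) by (simp add: g_def)
  also have "(\<lambda>x. x / r) ` {0..r} = {0..1}"
    using r(1) image_divide_atLeastAtMost[of r 0 r] by (simp add: divide_inverse)
  finally have gI: "((\<lambda>t. 4 * pi / 3 * g t ^ 3) has_integral 4 * pi / 3 * (I / r)) {0..1}"
    by (rule has_integral_mult_right)
  have I0: "0 \<le> I"
    unfolding I_def using r1 profile_pos
    by (intro integral_nonneg integrable_profile_power) (auto simp: less_imp_le)
  have "emeasure lborel {y. norm y \<le> g (\<bar>a \<bullet> y\<bar> / norm y)}
      = (\<integral>\<^sup>+t. ennreal (4 * pi / 3 * g t ^ 3) * indicator {0..1} t \<partial>lborel)"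
    using a g by (rule emeasure_polar_subgraph) (simp add: g_def profile_pos less_imp_le)
  also have "\<dots> = ennreal (4 * pi / 3 * (I / r))"
    using gI by (intro nn_integral_has_integral_lebesgue') (auto simp: g_def profile_pos less_imp_le)
  finally have e: "emeasure lborel {y. norm y \<le> g (\<bar>a \<bullet> y\<bar> / norm y)} = ennreal (4 * pi / 3 * (I / r))" .
  have "section_volume K \<xi> = measure lebesgue {y. norm y \<le> g (\<bar>a \<bullet> y\<bar> / norm y)}"
    unfolding section_volume_eq[OF f \<open>\<xi> \<noteq> 0\<close> compact_K] vim ..
  also have "\<dots> = measure lborel {y. norm y \<le> g (\<bar>a \<bullet> y\<bar> / norm y)}"
    by (rule measure_completion) measurable
  also have "\<dots> = 4 * pi / 3 * (I / r)"
    unfolding measure_def e using I0 r(1) by simp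
  finally show ?thesis
    by (simp add: I_def)
qed

end

subsection \<open>Expansion at the equator\<close>

text \<open>Here \<open>f\<close> is F' and \<open>f1\<close> is F''(1). In the variable
  \<open>x = z\<^sup>2\<close>, \<open>\<psi>\<close> has derivative \<open>Q (s x) / 2\<close>, so
  \<open>D x = \<psi> (4 * x) - 4 * \<psi> x\<close> increases where
  \<open>Q (s x) < Q (s (4 * x))\<close>. For small \<open>x > 0\<close> this follows from the
  positive derivative of \<open>Q (s x)\<close> at 0, which replaces a fourth-order expansion in
  \<open>z\<close>.\<close>

lemma second_difference_pos:
  fixes F f :: "real \<Rightarrow> real"
  assumes a: "0 \<le> a" "a < 1"
    and dF: "\<And>r. a < r \<Longrightarrow> r \<le> 1 \<Longrightarrow> (F has_real_derivative f r) (at r within {0..1})"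
    and Fpos: "\<And>r. a < r \<Longrightarrow> r \<le> 1 \<Longrightarrow> 0 < F r"
    and df: "(f has_real_derivative f1) (at 1 within {0..1})"
    and less: "F 1 * (3 * f 1 + f1) < 2 * (f 1)\<^sup>2"
  shows "\<exists>z>0. 0 < 1 / F (1 / sqrt (1 + (2 * z)\<^sup>2)) - 4 * (1 / F (1 / sqrt (1 + z\<^sup>2))) + 3 * (1 / F 1)"
proof -
  define s where "s x = 1 / sqrt (1 + x)" for x :: real
  define Q where "Q r = r ^ 3 * f r / (F r)\<^sup>2" for r
  define \<psi> where "\<psi> x = 1 / F (s x)" for x
  have s0: "s 0 = 1"
    by (simp add: s_def)
  have s1: "0 < s x" "s x \<le> 1" if "0 \<le> x" for x
    using that by (auto simp: s_def)
  have simg: "s ` {0..} \<subseteq> {0..1}"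
    using s1 by (auto simp: less_imp_le)
  \<comment> \<open>The bound \<open>1 - a\<close> keeps \<open>s x\<close> where \<open>F\<close>
    is assumed differentiable, because \<open>a\<^sup>2 * (1 + x) \<le> a * (2 - a) = 1 - (1 -
    a)\<^sup>2 < 1\<close>.\<close>
  have sa: "a < s x" if "0 \<le> x" "x < 1 - a" for x
  proof -
    have "a * (1 + x) \<le> 1 * (1 + x)"
      using that a by (intro mult_right_mono) auto
    also have "\<dots> \<le> 2 - a"
      using that by simp
    finally have "a * (a * (1 + x)) \<le> a * (2 - a)"
      using a by (intro mult_left_mono) auto
    then have "a\<^sup>2 * (1 + x) \<le> a * (2 - a)"
      by (simp add: power2_eq_square mult.assoc)
    also have "\<dots> = 1 - (1 - a)\<^sup>2"
      by (simp add: power2_eq_square algebra_simps)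
    also have "\<dots> < 1"
      using a by simp
    finally have "(a * sqrt (1 + x))\<^sup>2 < 1\<^sup>2"
      using that by (simp add: power_mult_distrib)
    then have "a * sqrt (1 + x) < 1"
      by (rule power2_less_imp_less) simp
    then show ?thesis
      using that by (simp add: s_def field_simps)
  qed
  have ds: "(s has_real_derivative - (s x ^ 3) / 2) (at x within {0..})" if "0 \<le> x" for x
    unfolding s_def using that
    by (auto intro!: derivative_eq_intros simp: power3_eq_cube power2_eq_square divide_simps)
  have d\<psi>: "(\<psi> has_real_derivative Q (s x) / 2) (at x within {0..})" if x: "0 \<le> x" "x < 1 - a" for x
  proof -
    \<comment> \<open>Derivatives at 1 are one-sided, so the chain rule is used within the image of
      \<open>{0..}\<close> under \<open>s\<close>, which lies in \<open>{0..1}\<close>.\<close>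
    have "(F has_real_derivative f (s x)) (at (s x) within s ` {0..})"
      using dF[OF sa[OF x] s1(2)[OF x(1)]] simg by (rule has_field_derivative_subset)
    from DERIV_image_chain[OF this ds[OF x(1)]]
    have "((\<lambda>x. F (s x)) has_real_derivative f (s x) * (- (s x ^ 3) / 2)) (at x within {0..})"
      by (simp add: o_def)
    moreover have "F (s x) \<noteq> 0"
      using Fpos[OF sa[OF x] s1(2)[OF x(1)]] by simp
    ultimately show ?thesis
      unfolding \<psi>_def Q_def
      by (auto intro!: derivative_eq_intros simp: field_simps power2_eq_square)
  qed
  \<comment> \<open>This is \<open>- 1 / 2\<close>, the slope of \<open>s\<close> at 0, times the
    derivative of \<open>Q\<close> at 1.\<close>
  define c where "c = (2 * (f 1)\<^sup>2 - F 1 * (3 * f 1 + f1)) / (2 * F 1 ^ 3)"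
  have F1: "0 < F 1"
    using Fpos a by simp
  have c: "0 < c"
    unfolding c_def using less F1 by (intro divide_pos_pos) auto
  have dq: "((\<lambda>x. Q (s x)) has_real_derivative c) (at 0 within {0..})"
  proof -
    have "(F has_real_derivative f 1) (at 1 within {0..1})"
      using dF a by simp
    then have "(Q has_real_derivative - 2 * c) (at 1 within {0..1})"
      unfolding Q_def using df F1
      by (auto intro!: derivative_eq_intros simp: c_def field_simps power2_eq_square power3_eq_cube)
    then have "(Q has_real_derivative - 2 * c) (at (s 0) within s ` {0..})"
      unfolding s0 using simg by (rule has_field_derivative_subset)
    from DERIV_image_chain[OF this ds[OF order_refl]] show ?thesis
      by (simp add: o_def s0)
  qed
  have stretch: "(\<lambda>x::real. 4 * x) ` {0..} = {0..}"
    by (auto intro!: image_eqI[of _ _ "_ / 4"])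
  have d4: "((\<lambda>x::real. 4 * x) has_real_derivative 4) (at x within {0..})" for x
    by (auto intro!: derivative_eq_intros)
  have "((\<lambda>x. Q (s (4 * x))) has_real_derivative c * 4) (at 0 within {0..})"
    using DERIV_image_chain[of "\<lambda>x. Q (s x)" c "\<lambda>x. 4 * x" 0 "{0..}" 4] dq d4 by (simp add: o_def stretch)
  from DERIV_diff[OF this dq]
  have "((\<lambda>x. Q (s (4 * x)) - Q (s x)) has_real_derivative 3 * c) (at 0 within {0..})"
    by (simp add: algebra_simps)
  from has_real_derivative_pos_inc_right[OF this] c
  obtain d where d: "0 < d" "\<And>h. 0 < h \<Longrightarrow> h < d \<Longrightarrow> Q (s h) < Q (s (4 * h))"
    by auto
  \<comment> \<open>Below \<open>d\<close> the values of \<open>Q\<close> compare as required; the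
    second bound keeps \<open>4 * x\<close> below \<open>1 - a\<close>.\<close>
  define \<delta> where "\<delta> = min (d / 2) ((1 - a) / 8)"
  have \<delta>: "0 < \<delta>" "\<delta> < d" "4 * \<delta> < 1 - a"
    using d(1) a by (auto simp: \<delta>_def min_def)
  define D where "D x = \<psi> (4 * x) - 4 * \<psi> x" for x
  have dD: "(D has_real_derivative 2 * (Q (s (4 * x)) - Q (s x))) (at x within {0..})"
    if "0 \<le> x" "x \<le> \<delta>" for x
  proof -
    have "(\<psi> has_real_derivative Q (s (4 * x)) / 2) (at (4 * x) within (\<lambda>x. 4 * x) ` {0..})"
      unfolding stretch using that \<delta> by (intro d\<psi>) auto
    from DERIV_image_chain[OF this d4]
    have "((\<lambda>x. \<psi> (4 * x)) has_real_derivative 2 * Q (s (4 * x))) (at x within {0..})"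
      by (simp add: o_def)
    moreover have "(\<psi> has_real_derivative Q (s x) / 2) (at x within {0..})"
      using that \<delta> by (intro d\<psi>) auto
    ultimately show ?thesis
      unfolding D_def by (auto intro!: derivative_eq_intros)
  qed
  \<comment> \<open>As \<open>D 0 = - 3 * \<psi> 0\<close>, this is already the claim for
    \<open>z = sqrt \<delta>\<close>, where \<open>(2 * z)\<^sup>2 = 4 * \<delta>\<close>.\<close>
  have "D 0 < D \<delta>"
  proof (rule DERIV_pos_imp_increasing_open[OF \<delta>(1)])
    fix x assume x: "0 < x" "x < \<delta>"
    then have "at x within {0..} = at x"
      by (intro at_within_interior) (simp add: interior_Ici[of "-1"])
    then have "DERIV D x :> 2 * (Q (s (4 * x)) - Q (s x))"
      using dD[of x] x by simp
    moreover have "0 < 2 * (Q (s (4 * x)) - Q (s x))"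
      using d(2)[of x] x \<delta> by simp
    ultimately show "\<exists>y. DERIV D x :> y \<and> 0 < y"
      by blast
  next
    show "continuous_on {0..\<delta>} D"
      unfolding continuous_on_eq_continuous_within
    proof
      fix x assume "x \<in> {0..\<delta>}"
      then have "(D has_real_derivative 2 * (Q (s (4 * x)) - Q (s x))) (at x within {0..\<delta>})"
        by (intro has_field_derivative_subset[OF dD]) auto
      then show "continuous (at x within {0..\<delta>}) D"
        by (rule DERIV_continuous)
    qed
  qed
  moreover have "\<psi> 0 = 1 / F 1"
    by (simp add: \<psi>_def s0)
  ultimately have "0 < \<psi> (4 * \<delta>) - 4 * \<psi> \<delta> + 3 * (1 / F 1)"
    by (simp add: D_def)
  then have "0 < 1 / F (1 / sqrt (1 + (2 * sqrt \<delta>)\<^sup>2)) - 4 * (1 / F (1 / sqrt (1 + (sqrt \<delta>)\<^sup>2))) + 3 * (1 / F 1)"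
    using \<delta>(1) by (simp add: \<psi>_def s_def power_mult_distrib)
  then show ?thesis
    using \<delta>(1) by (intro exI[of _ "sqrt \<delta>"]) simp
qed

subsection \<open>Zonoids\<close>

definition at_height :: "real^3 \<Rightarrow> real \<Rightarrow> real^4" where
  "at_height w z = (\<chi> i. if i = 1 then w $ 1 else if i = 2 then w $ 2 else if i = 3 then w $ 3 else z)"

definition equatorial :: "real^4 \<Rightarrow> real^3" where
  "equatorial v = vector [v $ 1, v $ 2, v $ 3]"

lemma at_height_nth: "at_height w z $ 1 = w $ 1" "at_height w z $ 2 = w $ 2" "at_height w z $ 3 = w $ 3" "at_height w z $ 4 = z"
  by (simp_all add: at_height_def)

lemma inner_at_height: "at_height w z \<bullet> v = equatorial v \<bullet> w + z * v $ 4"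
  unfolding inner_vec_def sum_4 sum_3 at_height_nth by (simp add: equatorial_def mult.commute)

lemma norm_at_height: "norm (at_height w z) = sqrt ((norm w)\<^sup>2 + z\<^sup>2)"
  unfolding norm_eq_sqrt_inner[of "at_height w z"] power2_norm_eq_inner inner_vec_def sum_4 sum_3 at_height_nth
  by (simp add: power2_eq_square)

lemma continuous_equatorial: "continuous_on UNIV equatorial"
proof -
  have eq: "equatorial = (\<lambda>v. v $ 1 *\<^sub>R axis 1 1 + v $ 2 *\<^sub>R axis 2 1 + v $ 3 *\<^sub>R axis 3 1)"
    by (auto simp: fun_eq_iff vec_eq_iff forall_3 axis_def equatorial_def)
  show ?thesis
    unfolding eq by (intro continuous_intros)
qed

text \<open>The division by \<open>sqrt (1 + z\<^sup>2)\<close> encodes homogeneity of the support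
  function. For every unit \<open>w\<close> the left side is a \<open>\<mu>\<close>-integral with
  the same value, so integrating over \<open>w = y /\<^sub>R norm y\<close> with \<open>y\<close> in
  the unit ball only multiplies it by the volume of the ball. After Fubini the inner integral is
  nonpositive for each \<open>v\<close>.\<close>

lemma zonoid_second_difference:
  fixes Z :: "(real^4) set" and \<phi> :: "real \<Rightarrow> real"
  assumes Z: "zonoid Z"
    and \<phi>: "\<And>w z. norm w = 1 \<Longrightarrow> support Z (at_height w z /\<^sub>R sqrt (1 + z\<^sup>2)) = \<phi> z / sqrt (1 + z\<^sup>2)"
    and even: "\<And>z. \<phi> (- z) = \<phi> z" and z: "0 \<le> z"
  shows "\<phi> (2 * z) - 4 * \<phi> z + 3 * \<phi> 0 \<le> 0"
proof -
  obtain \<mu> where sets: "sets \<mu> = sets (restrict_space borel (sphere (0::real^4) 1))"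
    and fin: "finite_measure \<mu>"
    and "\<forall>u\<in>sphere 0 1. support Z u = (\<integral>v. \<bar>u \<bullet> v\<bar> \<partial>\<mu>)"
    using Z unfolding zonoid_def by blast
  then have h: "support Z u = (\<integral>v. \<bar>u \<bullet> v\<bar> \<partial>\<mu>)" if "norm u = 1" for u
    using that by simp
  interpret \<mu>: finite_measure \<mu> by fact
  have space: "space \<mu> = sphere 0 1"
    using sets_eq_imp_space_eq[OF sets] by (simp add: space_restrict_space)
  have borel_\<mu>: "g \<in> borel_measurable \<mu>" if "g \<in> borel_measurable borel"
    for g :: "real^4 \<Rightarrow> 'b::topological_space"
    unfolding measurable_cong_sets[OF sets refl] using that by (rule measurable_restrict_space1)
  have [measurable]: "equatorial \<in> borel_measurable borel"
    using continuous_equatorial by (rule borel_measurable_continuous_onI)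
  have \<phi>_integral: "\<phi> z = (\<integral>v. \<bar>equatorial v \<bullet> w + z * v $ 4\<bar> \<partial>\<mu>)" if w: "norm w = 1" for w z
  proof -
    have pos: "0 < sqrt (1 + z\<^sup>2)"
      by (simp add: add_pos_nonneg)
    have "norm (at_height w z /\<^sub>R sqrt (1 + z\<^sup>2)) = 1"
      using w pos by (simp add: norm_at_height)
    then have "\<phi> z / sqrt (1 + z\<^sup>2) = (\<integral>v. \<bar>(at_height w z /\<^sub>R sqrt (1 + z\<^sup>2)) \<bullet> v\<bar> \<partial>\<mu>)"
      using \<phi>[OF w, of z] h by simp
    also have "\<dots> = (\<integral>v. \<bar>equatorial v \<bullet> w + z * v $ 4\<bar> / sqrt (1 + z\<^sup>2) \<partial>\<mu>)"
      using pos by (intro Bochner_Integration.integral_cong refl) (simp add: inner_at_height abs_mult divide_inverse mult.commute)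
    also have "\<dots> = (\<integral>v. \<bar>equatorial v \<bullet> w + z * v $ 4\<bar> \<partial>\<mu>) / sqrt (1 + z\<^sup>2)"
      by (rule integral_divide_zero)
    finally show ?thesis
      using pos by simp
  qed
  have bound: "\<bar>equatorial v \<bullet> w\<bar> \<le> 1" "\<bar>v $ 4\<bar> \<le> 1" if "v \<in> space \<mu>" "norm w = 1" for v w
  proof -
    have v: "norm v = 1"
      using that(1) space by simp
    show "\<bar>v $ 4\<bar> \<le> 1"
      using component_le_norm_cart[of v 4] v by simp
    show "\<bar>equatorial v \<bullet> w\<bar> \<le> 1"
      using Cauchy_Schwarz_ineq2[of "at_height w 0" v] that(2) v by (simp add: inner_at_height norm_at_height)
  qed
  have integrable_max: "integrable \<mu> (\<lambda>v. max \<bar>equatorial v \<bullet> w\<bar> (b * \<bar>v $ 4\<bar>))"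
    if w: "norm w = 1" and b: "0 \<le> b" for w b
  proof (rule \<mu>.integrable_const_bound[of _ "max 1 b"])
    have "norm (max \<bar>equatorial v \<bullet> w\<bar> (b * \<bar>v $ 4\<bar>)) \<le> max 1 b" if "v \<in> space \<mu>" for v
      using bound[OF that w] b mult_left_le[of "\<bar>v $ 4\<bar>" b] by (auto simp: max_def)
    then show "AE v in \<mu>. norm (max \<bar>equatorial v \<bullet> w\<bar> (b * \<bar>v $ 4\<bar>)) \<le> max 1 b"
      by (rule AE_I2)
  qed (intro borel_\<mu>, measurable)
  have \<phi>_max: "\<phi> b = (\<integral>v. max \<bar>equatorial v \<bullet> w\<bar> (b * \<bar>v $ 4\<bar>) \<partial>\<mu>)" if w: "norm w = 1" and b: "0 \<le> b" for w b
  proof -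
    have int: "integrable \<mu> (\<lambda>v. \<bar>equatorial v \<bullet> w + c * v $ 4\<bar>)" for c
    proof (rule \<mu>.integrable_const_bound[of _ "1 + \<bar>c\<bar>"])
      have "norm \<bar>equatorial v \<bullet> w + c * v $ 4\<bar> \<le> 1 + \<bar>c\<bar>" if "v \<in> space \<mu>" for v
        using bound[OF that w] mult_left_le[of "\<bar>v $ 4\<bar>" "\<bar>c\<bar>"] abs_triangle_ineq[of "equatorial v \<bullet> w" "c * v $ 4"]
        by (simp add: abs_mult)
      then show "AE v in \<mu>. norm \<bar>equatorial v \<bullet> w + c * v $ 4\<bar> \<le> 1 + \<bar>c\<bar>"
        by (rule AE_I2)
    qed (intro borel_\<mu>, measurable)
    have max: "\<bar>x + y\<bar> + \<bar>x - y\<bar> = 2 * max \<bar>x\<bar> \<bar>y\<bar>" for x y :: real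
      by (simp add: abs_if max_def)
    have "2 * \<phi> b = \<phi> b + \<phi> (- b)"
      by (simp add: even)
    also have "\<dots> = (\<integral>v. \<bar>equatorial v \<bullet> w + b * v $ 4\<bar> + \<bar>equatorial v \<bullet> w + (- b) * v $ 4\<bar> \<partial>\<mu>)"
      unfolding \<phi>_integral[OF w] by (intro Bochner_Integration.integral_add[symmetric] int)
    also have "\<dots> = (\<integral>v. 2 * max \<bar>equatorial v \<bullet> w\<bar> (b * \<bar>v $ 4\<bar>) \<partial>\<mu>)"
      using b by (intro Bochner_Integration.integral_cong refl) (simp add: max abs_mult)
    also have "\<dots> = 2 * (\<integral>v. max \<bar>equatorial v \<bullet> w\<bar> (b * \<bar>v $ 4\<bar>) \<partial>\<mu>)"
      by (rule integral_mult_right_zero)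
    finally show ?thesis
      by simp
  qed
  \<comment> \<open>This is the integrand of the second difference for the direction of
    \<open>y\<close>; in the term for \<open>\<phi> 0\<close> the maximum with 0 is just the
    absolute value.\<close>
  define J where "J y v = max (\<bar>equatorial v \<bullet> y\<bar> / norm y) (2 * (z * \<bar>v $ 4\<bar>))
    - 4 * max (\<bar>equatorial v \<bullet> y\<bar> / norm y) (z * \<bar>v $ 4\<bar>) + 3 * (\<bar>equatorial v \<bullet> y\<bar> / norm y)" for y v
  define L where "L = \<phi> (2 * z) - 4 * \<phi> z + 3 * \<phi> 0"
  have J: "(\<integral>v. J y v \<partial>\<mu>) = L" if "y \<noteq> 0" for y
  proof -
    define w where "w = y /\<^sub>R norm y"
    have w: "norm w = 1"
      using that by (simp add: w_def)
    have "\<bar>equatorial v \<bullet> y\<bar> / norm y = \<bar>equatorial v \<bullet> w\<bar>" for v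
      by (simp add: w_def abs_mult divide_inverse mult.commute)
    then have "J y v = max \<bar>equatorial v \<bullet> w\<bar> ((2 * z) * \<bar>v $ 4\<bar>)
        - 4 * max \<bar>equatorial v \<bullet> w\<bar> (z * \<bar>v $ 4\<bar>) + 3 * max \<bar>equatorial v \<bullet> w\<bar> (0 * \<bar>v $ 4\<bar>)" for v
      by (simp add: J_def mult.assoc)
    then show ?thesis
      unfolding L_def using z
      by (simp add: \<phi>_max[OF w] integrable_max[OF w] integrable_max[OF w order_refl, simplified])
  qed
  define \<beta> where "\<beta> = restrict_space lborel (ball (0::real^3) 1)"
  have emeasure_\<beta>: "emeasure \<beta> (space \<beta>) = ennreal (4 * pi / 3)"
    by (simp add: \<beta>_def space_restrict_space emeasure_restrict_space emeasure_ball unit_ball_vol_3)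
  then have "finite_measure \<beta>"
    by (intro finite_measureI) simp
  then interpret \<beta>: finite_measure \<beta> .
  have [measurable]: "(\<lambda>y. y) \<in> borel_measurable \<beta>"
    unfolding \<beta>_def by (intro measurable_restrict_space1) simp
  have [measurable]: "equatorial \<in> borel_measurable \<mu>" "(\<lambda>v. v $ 4) \<in> borel_measurable \<mu>"
    by (intro borel_\<mu>; measurable)+
  interpret pair_sigma_finite \<mu> \<beta> ..
  interpret P: finite_measure "\<mu> \<Otimes>\<^sub>M \<beta>"
    by (rule finite_measure_pair_measure) fact+
  have "integrable (\<mu> \<Otimes>\<^sub>M \<beta>) (\<lambda>(v, y). J y v)"
  \<comment> \<open>The bound adds up \<open>1 + 2 * z\<close>, \<open>4 + 4 * z\<close> and 3, one
    for each term of \<open>J\<close>.\<close>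
  proof (rule P.integrable_const_bound[of _ "8 + 6 * z"])
    have "norm (J y v) \<le> 8 + 6 * z" if v: "v \<in> space \<mu>" for v y
    proof -
      have "\<bar>equatorial v \<bullet> y\<bar> / norm y \<le> 1"
      proof (cases "y = 0")
        case False
        then show ?thesis
          using bound(1)[OF v, of "y /\<^sub>R norm y"] by (simp add: abs_mult divide_inverse mult.commute)
      qed simp
      moreover have "z * \<bar>v $ 4\<bar> \<le> z"
        using bound(2)[OF v, of "axis 1 1"] z by (intro mult_left_le) auto
      moreover have "0 \<le> z * \<bar>v $ 4\<bar>" "0 \<le> \<bar>equatorial v \<bullet> y\<bar> / norm y"
        using z by auto
      moreover have "\<bar>max x (2 * b) - 4 * max x b + 3 * x\<bar> \<le> 8 + 6 * z"
        if "0 \<le> x" "x \<le> 1" "0 \<le> b" "b \<le> z" for x b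
        using that by (auto simp: max_def abs_if)
      ultimately show ?thesis
        by (simp only: J_def real_norm_def)
    qed
    then show "AE x in \<mu> \<Otimes>\<^sub>M \<beta>. norm (case x of (v, y) \<Rightarrow> J y v) \<le> 8 + 6 * z"
      by (intro AE_I2) (auto simp: space_pair_measure)
    show "(\<lambda>(v, y). J y v) \<in> borel_measurable (\<mu> \<Otimes>\<^sub>M \<beta>)"
      unfolding J_def by measurable
  qed
  from Fubini_integral[OF this]
  have "(\<integral>y. (\<integral>v. J y v \<partial>\<mu>) \<partial>\<beta>) = (\<integral>v. (\<integral>y. J y v \<partial>\<beta>) \<partial>\<mu>)" .
  also have "\<dots> \<le> 0"
  proof -
    \<comment> \<open>The averaging inequality is applied with \<open>p = equatorial v\<close> and
      \<open>b = z * \<bar>v $ 4\<bar>\<close>.\<close>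
    have "(\<integral>y. J y v \<partial>\<beta>) \<le> 0" for v
      unfolding J_def \<beta>_def by (rule integral_ball_second_difference_nonpos) (use z in auto)
    then have "0 \<le> (\<integral>v. - (\<integral>y. J y v \<partial>\<beta>) \<partial>\<mu>)"
      by (intro Bochner_Integration.integral_nonneg) auto
    then show ?thesis
      by simp
  qed
  also have "(\<integral>y. (\<integral>v. J y v \<partial>\<mu>) \<partial>\<beta>) = (\<integral>y. L \<partial>\<beta>)"
  proof (rule integral_cong_AE)
    have "AE y in \<beta>. y \<noteq> 0"
      unfolding \<beta>_def using AE_lborel_singleton[of "0::real^3"] by (subst AE_restrict_space_iff) auto
    then show "AE y in \<beta>. (\<integral>v. J y v \<partial>\<mu>) = L"
      by eventually_elim (rule J)
    show "(\<lambda>y. \<integral>v. J y v \<partial>\<mu>) \<in> borel_measurable \<beta>"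
      unfolding J_def by measurable
  qed simp
  also have "\<dots> = 4 * pi / 3 * L"
    by (simp add: measure_def emeasure_\<beta>)
  finally have "4 * pi / 3 * L \<le> 0" .
  moreover have "0 < 4 * pi / 3"
    by simp
  ultimately have "L \<le> 0"
    by (simp add: mult_le_0_iff)
  then show ?thesis
    by (simp add: L_def)
qed

text \<open>For \<open>c > 0\<close>, the point \<open>c *\<^sub>R u\<close> lies in the body iff
  \<open>c \<le> section_volume K u\<close>, and in the polar iff
  \<open>c * support Z u \<le> 1\<close>. Equal thresholds make the two values reciprocal.\<close>

lemma support_polar_intersection_body:
  assumes Z: "zonoid Z" and eq: "intersection_body K = polar Z" and u: "norm u = 1"
  shows "section_volume K u * support Z u = 1"
proof -
  let ?h = "support Z u"
  let ?v = "section_volume K u"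
  have v0: "0 \<le> ?v"
    by (simp add: section_volume_def)
  have cZ: "compact Z" and neZ: "Z \<noteq> {}"
    using Z by (auto simp: zonoid_def)
  obtain B where B: "\<And>y. y \<in> Z \<Longrightarrow> norm y \<le> B"
    using compact_imp_bounded[OF cZ] by (auto simp: bounded_iff)
  have le_h: "u \<bullet> y \<le> ?h" if "y \<in> Z" for y
    unfolding support_def
  proof (rule cSup_upper)
    show "bdd_above {u \<bullet> y |y. y \<in> Z}"
      using B u by (auto intro!: bdd_aboveI[of _ B] order.trans[OF norm_cauchy_schwarz])
  qed (use that in auto)
  have h_le: "?h \<le> c" if "\<And>y. y \<in> Z \<Longrightarrow> u \<bullet> y \<le> c" for c
    unfolding support_def using neZ that by (intro cSup_least) auto
  have iff: "c \<le> ?v \<longleftrightarrow> c * ?h \<le> 1" if c: "0 < c" for c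
  proof -
    have "c \<le> ?v \<longleftrightarrow> c *\<^sub>R u \<in> intersection_body K"
    proof
      assume "c \<le> ?v"
      then show "c *\<^sub>R u \<in> intersection_body K"
        unfolding intersection_body_def using u c by (auto intro!: exI[of _ c] exI[of _ u])
    next
      assume "c *\<^sub>R u \<in> intersection_body K"
      then obtain d \<eta> where d: "c *\<^sub>R u = d *\<^sub>R \<eta>" "norm \<eta> = 1" "0 \<le> d" "d \<le> section_volume K \<eta>"
        by (auto simp: intersection_body_def)
      have "norm (c *\<^sub>R u) = norm (d *\<^sub>R \<eta>)"
        using d(1) by (rule arg_cong)
      then have "c = d"
        using d(2,3) u c by simp
      then show "c \<le> ?v"
        using d c by simp
    qed
    also have "\<dots> \<longleftrightarrow> (\<forall>y\<in>Z. u \<bullet> y \<le> 1 / c)"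
      unfolding eq polar_def using c by (auto simp: pos_le_divide_eq mult.commute)
    also have "\<dots> \<longleftrightarrow> ?h \<le> 1 / c"
      using le_h h_le by (meson order.trans)
    finally show ?thesis
      using c by (simp add: pos_le_divide_eq mult.commute)
  qed
  \<comment> \<open>A nonpositive support value would put every positive multiple of
    \<open>u\<close> into the polar, against the finite section volume.\<close>
  have h: "0 < ?h"
  proof (rule ccontr)
    assume "\<not> 0 < ?h"
    then have "(?v + 1) * ?h \<le> 1"
      using v0 mult_nonneg_nonpos[of "?v + 1" ?h] by simp
    then show False
      using iff[of "?v + 1"] v0 by simp
  qed
  \<comment> \<open>The equivalence is used at \<open>c = 1 / ?h\<close> and then at
    \<open>c = ?v\<close>, giving both inequalities.\<close>
  then have "1 / ?h \<le> ?v"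
    by (subst iff) auto
  moreover from this have "?v * ?h \<le> 1"
    using h by (subst iff[symmetric]) (auto intro: less_le_trans[of 0 "1 / ?h"])
  ultimately show ?thesis
    using h by (simp add: pos_divide_le_eq)
qed

section \<open>The second difference for a body of revolution\<close>

context symmetric_revolution_body
begin

text \<open>A ball about the origin inside \<open>K\<close> bounds the profile below by its
  radius.\<close>

lemma integral_profile_pos:
  assumes "0 < r" "r \<le> 1"
  shows "0 < integral {0..r} (\<lambda>t. \<rho> t ^ 3)"
proof -
  obtain e where e: "0 < e" "cball 0 e \<subseteq> K"
    using zero_interior mem_interior_cball by blast
  have le: "e \<le> \<rho> t" if "\<bar>t\<bar> \<le> 1" for t
    unfolding radial_profile_meridian using e that
    by (subst le_radial) (auto simp: meridian_nonzero norm_meridian intro!: subsetD[OF e(2)])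
  have "0 < e ^ 3 * r"
    using e assms by simp
  also have "e ^ 3 * r = integral {0..r} (\<lambda>t. e ^ 3)"
    using assms by simp
  also have "\<dots> \<le> integral {0..r} (\<lambda>t. \<rho> t ^ 3)"
    using assms e le by (intro integral_le integrable_profile_power power_mono) auto
  finally show ?thesis .
qed

text \<open>At height \<open>z\<close> the sine is \<open>r = 1 / sqrt (1 + z\<^sup>2)\<close>, so
  the reciprocal section volume is \<open>3 / (4 * pi) * r / F r\<close>. The factor
  \<open>r\<close> is the normalisation expected by \<open>zonoid_second_difference\<close>, and the
  rest depends on \<open>z\<^sup>2\<close> only, hence is even.\<close>

lemma polar_zonoid_second_difference:
  assumes "polar_zonoid (intersection_body K)" and z: "0 \<le> z"
  defines "F \<equiv> \<lambda>r. integral {0..r} (\<lambda>t. \<rho> t ^ 3)"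
  shows "1 / F (1 / sqrt (1 + (2 * z)\<^sup>2)) - 4 * (1 / F (1 / sqrt (1 + z\<^sup>2))) + 3 * (1 / F 1) \<le> 0"
proof -
  obtain Z where Z: "zonoid Z" "intersection_body K = polar Z"
    using assms(1) by (auto simp: polar_zonoid_def)
  define \<phi> where "\<phi> z = 3 / (4 * pi) * (1 / F (1 / sqrt (1 + z\<^sup>2)))" for z
  have "support Z (at_height w z /\<^sub>R sqrt (1 + z\<^sup>2)) = \<phi> z / sqrt (1 + z\<^sup>2)" if w: "norm w = 1" for w z
  proof -
    let ?u = "at_height w z /\<^sub>R sqrt (1 + z\<^sup>2)" and ?r = "1 / sqrt (1 + z\<^sup>2)"
    have pos: "0 < 1 + z\<^sup>2"
      by (simp add: add_pos_nonneg)
    have u: "norm ?u = 1"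
      using w pos by (simp add: norm_at_height)
    have r: "0 < ?r" "?r \<le> 1" "?r\<^sup>2 = 1 - (?u $ 4)\<^sup>2"
      using pos by (simp_all add: at_height_nth power_mult_distrib power_divide divide_simps)
    have volume: "section_volume K ?u = 4 * pi / 3 * F ?r / ?r"
      unfolding F_def using u r(1,3) by (rule section_volume_revolution)
    have "section_volume K ?u * support Z ?u = 1"
      using Z u by (rule support_polar_intersection_body)
    then have "support Z ?u = 1 / section_volume K ?u"
      by (metis mult_zero_left nonzero_mult_div_cancel_left zero_neq_one)
    also have "\<dots> = \<phi> z / sqrt (1 + z\<^sup>2)"
      unfolding volume \<phi>_def by simp
    finally show ?thesis .
  qed
  from zonoid_second_difference[OF Z(1) this _ z]
  have "\<phi> (2 * z) - 4 * \<phi> z + 3 * \<phi> 0 \<le> 0"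
    by (simp add: \<phi>_def)
  then have "3 / (4 * pi) * (1 / F (1 / sqrt (1 + (2 * z)\<^sup>2)) - 4 * (1 / F (1 / sqrt (1 + z\<^sup>2))) + 3 * (1 / F 1)) \<le> 0"
    by (simp add: \<phi>_def algebra_simps)
  moreover have "0 < 3 / (4 * pi)"
    by simp
  ultimately show ?thesis
    by (meson mult_pos_pos not_le)
qed

end

theorem proposition1:
  fixes K :: "(real^4) set" and a :: real
  assumes "convex_body K" and "origin_symmetric K" and "body_of_revolution K"
    and "0 \<le> a" and "a < 1" and "C2_on {a<..1} (radial_profile K)"
    and "2 * radial_profile K 1 ^ 4
           > 3 * integral {0..1} (\<lambda>t. radial_profile K t ^ 3)
               * (radial_profile K 1 + vector_derivative (radial_profile K) (at 1 within {0..1}))"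
  shows "\<not> polar_zonoid (intersection_body K)"
proof
  assume pz: "polar_zonoid (intersection_body K)"
  interpret symmetric_revolution_body K
    using assms by unfold_locales
  define F where "F r = integral {0..r} (\<lambda>t. \<rho> t ^ 3)" for r
  \<comment> \<open>Smoothness is given relative to \<open>{a<..1}\<close>, the derivative in the
    hypothesis relative to \<open>{0..1}\<close>; both sets agree near every
    \<open>t > a\<close>.\<close>
  have within: "at t within {a<..1} = at t within {0..1}" if "a < t" for t
    by (rule at_within_nhd[of t "{a<..}"]) (use that \<open>0 \<le> a\<close> in auto)
  obtain \<rho>' where d\<rho>: "\<And>t. a < t \<Longrightarrow> t \<le> 1 \<Longrightarrow> (\<rho> has_real_derivative \<rho>' t) (at t within {0..1})"
    using assms(6) within unfolding C2_on_def by (metis greaterThanAtMost_iff)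
  have d1: "(\<rho> has_real_derivative \<rho>' 1) (at 1 within {0..1})"
    using d\<rho> \<open>a < 1\<close> by simp
  then have "vector_derivative \<rho> (at 1 within {0..1}) = \<rho>' 1"
    by (intro vector_derivative_within_cbox[of 0 1, simplified])
      (auto simp: has_real_derivative_iff_has_vector_derivative)
  then have less: "3 * F 1 * (\<rho> 1 + \<rho>' 1) < 2 * \<rho> 1 ^ 4"
    using assms(7) by (simp add: F_def)
  have "\<exists>z>0. 0 < 1 / F (1 / sqrt (1 + (2 * z)\<^sup>2)) - 4 * (1 / F (1 / sqrt (1 + z\<^sup>2))) + 3 * (1 / F 1)"
  proof (rule second_difference_pos[OF \<open>0 \<le> a\<close> \<open>a < 1\<close>])
    show "(F has_real_derivative \<rho> r ^ 3) (at r within {0..1})" if "a < r" "r \<le> 1" for r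
    proof -
      \<comment> \<open>Given integrability on the whole interval, continuity of the integrand at
        the single point \<open>r\<close> yields the derivative of \<open>F\<close> there.\<close>
      have "continuous (at r within {0..1}) (\<lambda>t. \<rho> t ^ 3)"
        using d\<rho>[OF that] by (intro continuous_intros DERIV_continuous)
      then show ?thesis
        using integral_has_vector_derivative_continuous_at[of "\<lambda>t. \<rho> t ^ 3" 0 1 r "{}"]
          integrable_profile_power[of 0 1 3] that \<open>0 \<le> a\<close>
        by (simp add: F_def[abs_def] has_real_derivative_iff_has_vector_derivative)
    qed
    show "0 < F r" if "a < r" "r \<le> 1" for r
      unfolding F_def using that \<open>0 \<le> a\<close> by (intro integral_profile_pos) auto
    show "((\<lambda>t. \<rho> t ^ 3) has_real_derivative 3 * (\<rho> 1)\<^sup>2 * \<rho>' 1) (at 1 within {0..1})"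
      using d1 by (auto intro!: derivative_eq_intros)
    \<comment> \<open>With \<open>f = \<rho>\<^sup>3\<close> the factor
      \<open>(\<rho> 1)\<^sup>2\<close> turns the right side of the hypothesis into
      \<open>2 * (f 1)\<^sup>2\<close> and its left side into
      \<open>F 1 * (3 * f 1 + f1)\<close>.\<close>
    have "(\<rho> 1)\<^sup>2 * (3 * F 1 * (\<rho> 1 + \<rho>' 1)) < (\<rho> 1)\<^sup>2 * (2 * \<rho> 1 ^ 4)"
      using less profile_pos[of 1] by (intro mult_strict_left_mono) auto
    then show "F 1 * (3 * \<rho> 1 ^ 3 + 3 * (\<rho> 1)\<^sup>2 * \<rho>' 1) < 2 * (\<rho> 1 ^ 3)\<^sup>2"
      by (simp add: algebra_simps power2_eq_square power3_eq_cube power4_eq_xxxx)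
  qed
  then show False
    using polar_zonoid_second_difference[OF pz] unfolding F_def by (meson less_imp_le not_less)
qed

end
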